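(* For given $\alpha>0$ and $\delta\in\mathbb R$ set $$W_t=\sum_{j=1}^\infty\frac{Z_j}{(j+\delta)^{1/2+\alpha}}e_j(t),\qquad t\in[0,1],$$ where $Z_1,Z_2,\dots$ are independent standard normal random variables and $e_j(x)=\sqrt2\sin[(j-\tfrac12)\pi x]$. Then almost every realisation of $W$ is both polished tail and discrete polished tail (in the sense defined in the context).
   Context: A function with expansion $f=\sum_{j\ge1}f_je_j$ is identified with its coefficient sequence $(f_j)$; for $W$ this is $f_j=Z_j/(j+\delta)^{1/2+\alpha}$. Polished tail: for some $L,\rho>0$ and all sufficiently large $k$, $\sum_{j=k}^\infty f_j^2\le L\sum_{j=k}^{\rho k}f_j^2$. Discrete coefficients: the array $(f_{i,n})_{1\le i\le n}$ associated with $(f_j)$ is given by $f_{i,n}=\sqrt{n+1/2}\,\sum_{l=0}^\infty\bigl(f_{(2n+1)l+i}-f_{(2n+1)l+2n+2-i}\bigr)$. (These are the coordinates of the vector $(f(x_{1,n}),\dots,f(x_{n,n}))^T$, $x_{i,n}=i/(n+1/2)$, relative to the orthonormal basis $e_{j,n}=(n+1/2)^{-1/2}(e_j(x_{1,n}),\dots,e_j(x_{n,n}))^T$, $1\le j\le n$, of $\mathbb R^n$, when the expansion of $f$ converges pointwise.) Discrete polished tail: there exist constants $L$ and $\rho$ such that, for all sufficiently large $k$ (and hence sufficiently large $n$), $\sum_{i=k}^nf_{i,n}^2\le L\sum_{i=k}^{\rho k\wedge n}f_{i,n}^2$. *)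

theory Defs
  imports "HOL-Probability.Probability"
begin

text \<open>
  Coefficient sequences are indexed by \<open>j \<ge> 1\<close>; the entry at index \<open>0\<close> is never used.
\<close>

definition sine_basis :: "nat \<Rightarrow> real \<Rightarrow> real" where
  "sine_basis j x = sqrt 2 * sin ((real j - 1/2) * pi * x)"

text \<open>
  The expansion \<open>f = (\<Sum>j\<ge>1. c j * e\<^sub>j)\<close> is understood in \<open>L\<^sup>2[0,1]\<close>, so \<open>f\<close> matters only
  almost everywhere on \<open>[0,1]\<close>. As the \<open>e\<^sub>j\<close> are orthonormal there, \<open>c\<close> is determined by \<open>f\<close>
  on the indices \<open>j \<ge> 1\<close>.
\<close>

definition has_sine_expansion :: "(real \<Rightarrow> real) \<Rightarrow> (nat \<Rightarrow> real) \<Rightarrow> bool" where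
  "has_sine_expansion f c \<longleftrightarrow>
     f \<in> borel_measurable (lebesgue_on {0..1}) \<and>
     (\<lambda>N. \<integral>\<^sup>+ x. ennreal ((f x - (\<Sum>j=1..N. c j * sine_basis j x))\<^sup>2) \<partial>lebesgue_on {0..1})
       \<longlonglongrightarrow> 0"

text \<open>
  Square summability is required explicitly since \<^const>\<open>suminf\<close> is unspecified on divergent
  series. For real \<open>\<rho>\<close>, a sum up to \<open>\<rho> k\<close> is a sum up to \<open>\<lfloor>\<rho> k\<rfloor>\<close>.
\<close>

definition polished_tail_coeffs :: "(nat \<Rightarrow> real) \<Rightarrow> bool" where
  "polished_tail_coeffs c \<longleftrightarrow>
     summable (\<lambda>j. (c j)\<^sup>2) \<and>
     (\<exists>L \<rho> :: real. L > 0 \<and> \<rho> > 0 \<and>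
        (\<forall>\<^sub>F k in sequentially.
           (\<Sum>j. (c (k + j))\<^sup>2) \<le> L * (\<Sum>j = k..nat \<lfloor>\<rho> * real k\<rfloor>. (c j)\<^sup>2)))"

definition aliasing_term :: "(nat \<Rightarrow> real) \<Rightarrow> nat \<Rightarrow> nat \<Rightarrow> nat \<Rightarrow> real" where
  "aliasing_term c n i l = c ((2*n+1) * l + i) - c ((2*n+1) * l + (2*n+2-i))"

definition discrete_coeff :: "(nat \<Rightarrow> real) \<Rightarrow> nat \<Rightarrow> nat \<Rightarrow> real" where
  "discrete_coeff c n i = sqrt (real n + 1/2) * (\<Sum>l. aliasing_term c n i l)"

text \<open>
  The first conjunct says that the array of discrete coefficients is well defined; the series
  need not converge absolutely. Since the sums over \<open>i = k..n\<close> presuppose \<open>n \<ge> k\<close>, the inequality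
  is uniform in \<open>n \<ge> k\<close>.
\<close>

definition discrete_polished_tail_coeffs :: "(nat \<Rightarrow> real) \<Rightarrow> bool" where
  "discrete_polished_tail_coeffs c \<longleftrightarrow>
     (\<forall>n\<ge>1. \<forall>i\<in>{1..n}. summable (aliasing_term c n i)) \<and>
     (\<exists>L \<rho> :: real. L > 0 \<and> \<rho> > 0 \<and>
        (\<forall>\<^sub>F k in sequentially. \<forall>n\<ge>k.
           (\<Sum>i = k..n. (discrete_coeff c n i)\<^sup>2)
             \<le> L * (\<Sum>i = k..min (nat \<lfloor>\<rho> * real k\<rfloor>) n. (discrete_coeff c n i)\<^sup>2)))"

definition polished_tail :: "(real \<Rightarrow> real) \<Rightarrow> bool" where
  "polished_tail f \<longleftrightarrow> (\<exists>c. has_sine_expansion f c \<and> polished_tail_coeffs c)"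

definition discrete_polished_tail :: "(real \<Rightarrow> real) \<Rightarrow> bool" where
  "discrete_polished_tail f \<longleftrightarrow> (\<exists>c. has_sine_expansion f c \<and> discrete_polished_tail_coeffs c)"

text \<open>
  For the finitely many \<open>j\<close> with \<open>j + \<delta> \<le> 0\<close> the power is read through the total \<open>powr\<close>, i.e.\ as
  \<open>\<bar>j + \<delta>\<bar> powr (1/2 + \<alpha>)\<close>, and the coefficient is \<open>0\<close> if \<open>j + \<delta> = 0\<close>.
\<close>

definition W_coeff ::
  "real \<Rightarrow> real \<Rightarrow> (nat \<Rightarrow> 'a \<Rightarrow> real) \<Rightarrow> 'a \<Rightarrow> nat \<Rightarrow> real" where
  "W_coeff \<alpha> \<delta> Z \<omega> j = Z j \<omega> / (real j + \<delta>) powr (1/2 + \<alpha>)"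

definition W ::
  "real \<Rightarrow> real \<Rightarrow> (nat \<Rightarrow> 'a \<Rightarrow> real) \<Rightarrow> 'a \<Rightarrow> real \<Rightarrow> real" where
  "W \<alpha> \<delta> Z \<omega> t = (\<Sum>j. W_coeff \<alpha> \<delta> Z \<omega> (Suc j) * sine_basis (Suc j) t)"

end

theory Submission
  imports Defs
begin

text \<open>
  Put \<open>\<beta> = 2\<alpha>\<close> and \<open>c\<^sub>j = a\<^sub>j Z\<^sub>j\<close> with \<open>a\<^sub>j\<^sup>2\<close> of exact order \<open>j\<close> to the power \<open>-(1 + \<beta>)\<close>. Exponential
  moments and Borel--Cantelli show that almost surely, for all large \<open>k\<close>, the sum of the \<open>c\<^sub>j\<^sup>2\<close> over
  \<open>k \<le> j < 2k\<close> is of exact order \<open>k\<close> to the power \<open>-\<beta>\<close>; adding up dyadic blocks bounds the whole tail by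
  the same order, so \<open>c\<close> has a polished tail.

  Up to the factor \<open>sqrt (n + 1/2)\<close>, which cancels, the discrete coefficient is \<open>c\<^sub>i + r\<^sub>i\<close> with the remainder
  \<open>r\<^sub>i\<close> depending on \<open>n\<close> and collecting the aliased coefficients, whose indices all exceed \<open>n\<close>. For fixed
  \<open>n\<close> the \<open>r\<^sub>i\<close> are independent normals with variance \<open>O(n powr -(1 + \<beta>))\<close>, so the same argument, now over
  \<open>n\<close> only, bounds the sum of the \<open>r\<^sub>i\<^sup>2\<close> by \<open>D n powr -\<beta>\<close>. This splitting is what gives uniformity in \<open>n\<close>:
  a union bound over all pairs \<open>k \<le> n\<close> would diverge. If \<open>n > p k\<close> with \<open>p\<close> large, the remainder is negligible
  against the block of \<open>c\<close> starting at \<open>k\<close>, and if \<open>n \<le> p k\<close> the claim is trivial.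

  That \<open>W\<close>, a pointwise sum, has the expansion \<open>c\<close> follows from Kolmogorov's theorem on series of
  independent variables for fixed \<open>t\<close>, Fubini, and Fatou's lemma with orthonormality of the sines.
\<close>

subsection \<open>Series of independent random variables\<close>

text \<open>
  The partial sums frozen once they reach \<open>\<epsilon>\<close> in absolute value: the second moment of the frozen
  sum at time \<open>n\<close> controls the maximum of all partial sums up to \<open>n\<close>.
\<close>

primrec stopped_sum :: "real \<Rightarrow> (nat \<Rightarrow> real) \<Rightarrow> nat \<Rightarrow> real" where
  "stopped_sum \<epsilon> x 0 = 0"
| "stopped_sum \<epsilon> x (Suc k) =
     stopped_sum \<epsilon> x k + (if \<bar>stopped_sum \<epsilon> x k\<bar> < \<epsilon> then x k else 0)"

text \<open>Nothing is frozen before a partial sum reaches \<epsilon>, so until then both sums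
  agree; the first value to reach \<epsilon> is then kept forever.\<close>

lemma stopped_sum_cases:
  "if \<exists>j\<le>k. \<epsilon> \<le> \<bar>\<Sum>i<j. x i\<bar> then \<epsilon> \<le> \<bar>stopped_sum \<epsilon> x k\<bar> else stopped_sum \<epsilon> x k = (\<Sum>i<k. x i)"
proof (induction k)
  case (Suc k)
  show ?case
  proof (cases "\<exists>j\<le>k. \<epsilon> \<le> \<bar>\<Sum>i<j. x i\<bar>")
    case True
    then have "\<exists>j\<le>Suc k. \<epsilon> \<le> \<bar>\<Sum>i<j. x i\<bar>" by (meson le_SucI)
    moreover from True Suc have "\<epsilon> \<le> \<bar>stopped_sum \<epsilon> x k\<bar>" by (simp only: if_True)
    ultimately show ?thesis by simp
  next
    case False
    with Suc have T: "stopped_sum \<epsilon> x k = (\<Sum>i<k. x i)" by (simp only: if_False)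
    from False have "\<bar>\<Sum>i<k. x i\<bar> < \<epsilon>" by (meson not_le order_refl)
    with T have T': "stopped_sum \<epsilon> x (Suc k) = (\<Sum>i<Suc k. x i)" by simp
    have "(\<exists>j\<le>Suc k. \<epsilon> \<le> \<bar>\<Sum>i<j. x i\<bar>) \<longleftrightarrow> \<epsilon> \<le> \<bar>\<Sum>i<Suc k. x i\<bar>"
      using False by (metis le_Suc_eq)
    then show ?thesis unfolding T' by (simp only: split: if_split) blast
  qed
qed auto

text \<open>The stopped sum at time \<open>k\<close> is a function of the first \<open>k\<close>
  coordinates alone, which makes it independent of the next variable.\<close>

lemma stopped_sum_restrict: "stopped_sum \<epsilon> (restrict x {..<k}) k = stopped_sum \<epsilon> x k"
proof -
  have "j \<le> k \<Longrightarrow> stopped_sum \<epsilon> (restrict x {..<k}) j = stopped_sum \<epsilon> x j" for j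
    by (induction j) auto
  then show ?thesis by simp
qed

lemma stopped_sum_measurable_PiM:
  "(\<lambda>x. stopped_sum \<epsilon> x k) \<in> borel_measurable (Pi\<^sub>M {..<k} (\<lambda>_. borel))"
proof -
  have "j \<le> k \<Longrightarrow> (\<lambda>x. stopped_sum \<epsilon> x j) \<in> borel_measurable (Pi\<^sub>M {..<k} (\<lambda>_. borel))" for j
  proof (induction j)
    case (Suc j)
    then have [measurable]: "(\<lambda>x. stopped_sum \<epsilon> x j) \<in> borel_measurable (Pi\<^sub>M {..<k} (\<lambda>_. borel))"
      by simp
    have [measurable]: "(\<lambda>x. x j) \<in> borel_measurable (Pi\<^sub>M {..<k} (\<lambda>_. borel))"
      using Suc by (intro measurable_component_singleton) simp
    show ?case by simp measurable
  qed simp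
  then show ?thesis by simp
qed

context prob_space
begin

text \<open>Injectivity of \<open>p\<close> makes the singletons \<open>{p j}\<close> disjoint
  blocks; evaluation at the only coordinate of a block recovers the variable.\<close>

lemma indep_vars_reindex:
  assumes "indep_vars (\<lambda>_. N) X I" "inj_on p J" "p ` J \<subseteq> I"
  shows "indep_vars (\<lambda>_. N) (\<lambda>j. X (p j)) J"
proof -
  have "indep_vars (\<lambda>j. Pi\<^sub>M {p j} (\<lambda>_. N)) (\<lambda>j \<omega>. restrict (\<lambda>i. X i \<omega>) {p j}) J"
    using assms by (intro indep_vars_restrict) (auto simp: disjoint_family_on_def inj_on_def)
  then have "indep_vars (\<lambda>_. N) (\<lambda>j \<omega>. restrict (\<lambda>i. X i \<omega>) {p j} (p j)) J"
    by (rule indep_vars_compose2[where Y = "\<lambda>j f. f (p j)"]) simp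
  then show ?thesis by simp
qed

text \<open>Each step adds at most the second moment of \<open>X k\<close> to that of the stopped
  sum, because the cross term is a product of independent factors, one of mean zero. Markov's
  inequality for the square of the final stopped sum then controls all partial sums at once.\<close>

theorem kolmogorov_maximal_inequality:
  fixes X :: "nat \<Rightarrow> 'a \<Rightarrow> real"
  assumes indep: "indep_vars (\<lambda>_. borel) X {..<n}"
    and sq: "\<And>i. i < n \<Longrightarrow> integrable M (\<lambda>\<omega>. (X i \<omega>)\<^sup>2)"
    and mean: "\<And>i. i < n \<Longrightarrow> expectation (X i) = 0"
    and \<epsilon>: "0 < \<epsilon>"
  shows "prob {\<omega> \<in> space M. \<exists>k\<le>n. \<epsilon> \<le> \<bar>\<Sum>i<k. X i \<omega>\<bar>} \<le> (\<Sum>i<n. expectation (\<lambda>\<omega>. (X i \<omega>)\<^sup>2)) / \<epsilon>\<^sup>2"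
proof -
  have X_meas: "random_variable borel (X i)" if "i < n" for i
    using indep that by (simp add: indep_vars_def)
  have X_int: "integrable M (X i)" if "i < n" for i
    using square_integrable_imp_integrable[OF X_meas[OF that] sq[OF that]] .
  define T where "T k \<omega> = stopped_sum \<epsilon> (\<lambda>i. X i \<omega>) k" for k \<omega>
  have T_Suc: "T (Suc k) \<omega> = T k \<omega> + (if \<bar>T k \<omega>\<bar> < \<epsilon> then X k \<omega> else 0)" for k \<omega>
    by (simp add: T_def)
  have T_meas: "random_variable borel (T k)" if "k \<le> n" for k
    using that
  proof (induction k)
    case (Suc k)
    then have [measurable]: "random_variable borel (T k)" "random_variable borel (X k)"
      by (auto intro: X_meas)
    show ?case unfolding T_Suc[abs_def] by measurable
  qed (simp add: T_def[abs_def])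
  have main: "integrable M (\<lambda>\<omega>. (T k \<omega>)\<^sup>2) \<and>
      expectation (\<lambda>\<omega>. (T k \<omega>)\<^sup>2) \<le> (\<Sum>i<k. expectation (\<lambda>\<omega>. (X i \<omega>)\<^sup>2))" if "k \<le> n" for k
    using that
  proof (induction k)
    case (Suc k)
    then have k: "k < n" by simp
    note [measurable] = X_meas[OF k] T_meas[OF Suc_leD[OF Suc.prems]]
    \<comment> \<open>\<open>U\<close> is the stopped sum while it is still running and 0
      afterwards. It is bounded by \<epsilon>, so the cross term \<open>U * X k\<close> is
      integrable by independence.\<close>
    define g where "g t = (if \<bar>t\<bar> < \<epsilon> then t else 0)" for t :: real
    have [measurable]: "g \<in> borel_measurable borel" unfolding g_def by measurable
    define U where "U \<omega> = g (T k \<omega>)" for \<omega>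
    have [measurable]: "random_variable borel U" unfolding U_def by measurable
    have U_int: "integrable M U"
      by (rule integrable_const_bound[where B = \<epsilon>]) (use \<epsilon> in \<open>auto simp: U_def g_def\<close>)
    have "indep_var borel ((\<lambda>x. g (stopped_sum \<epsilon> x k)) \<circ> (\<lambda>\<omega>. restrict (\<lambda>i. X i \<omega>) {..<k}))
        borel ((\<lambda>x. x k) \<circ> (\<lambda>\<omega>. restrict (\<lambda>i. X i \<omega>) {k}))"
      using k stopped_sum_measurable_PiM
      by (intro indep_var_compose[OF indep_var_restrict[OF indep]] measurable_compose[OF stopped_sum_measurable_PiM]) auto
    then have iv: "indep_var borel U borel (X k)"
      by (simp add: comp_def U_def[abs_def] T_def stopped_sum_restrict)
    define V where "V \<omega> = (if \<bar>T k \<omega>\<bar> < \<epsilon> then (X k \<omega>)\<^sup>2 else 0)" for \<omega>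
    have V_int: "integrable M V"
      by (rule Bochner_Integration.integrable_bound[OF sq[OF k]]) (auto simp: V_def[abs_def])
    have V_le: "expectation V \<le> expectation (\<lambda>\<omega>. (X k \<omega>)\<^sup>2)"
      by (rule integral_mono[OF V_int sq[OF k]]) (auto simp: V_def)
    have UX_int: "integrable M (\<lambda>\<omega>. U \<omega> * X k \<omega>)"
      by (rule indep_var_integrable[OF iv U_int X_int[OF k]])
    have UX: "expectation (\<lambda>\<omega>. U \<omega> * X k \<omega>) = 0"
      using indep_var_lebesgue_integral[OF iv U_int X_int[OF k]] mean[OF k] by simp
    have T_sq: "(T (Suc k) \<omega>)\<^sup>2 = (T k \<omega>)\<^sup>2 + 2 * (U \<omega> * X k \<omega>) + V \<omega>" for \<omega>
      by (auto simp: T_Suc U_def V_def g_def power2_eq_square algebra_simps)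
    have IH: "integrable M (\<lambda>\<omega>. (T k \<omega>)\<^sup>2)"
      "expectation (\<lambda>\<omega>. (T k \<omega>)\<^sup>2) \<le> (\<Sum>i<k. expectation (\<lambda>\<omega>. (X i \<omega>)\<^sup>2))"
      using Suc by auto
    have "expectation (\<lambda>\<omega>. (T (Suc k) \<omega>)\<^sup>2) = expectation (\<lambda>\<omega>. (T k \<omega>)\<^sup>2) + expectation V"
      unfolding T_sq using IH(1) UX_int V_int UX by simp
    moreover have "integrable M (\<lambda>\<omega>. (T (Suc k) \<omega>)\<^sup>2)"
      unfolding T_sq using IH(1) UX_int V_int by simp
    ultimately show ?case using IH V_le by simp
  qed (simp add: T_def)
  note [measurable] = T_meas[OF order_refl]
  have "prob {\<omega> \<in> space M. \<exists>k\<le>n. \<epsilon> \<le> \<bar>\<Sum>i<k. X i \<omega>\<bar>} \<le> prob {\<omega> \<in> space M. \<epsilon>\<^sup>2 \<le> (T n \<omega>)\<^sup>2}"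
  proof (rule finite_measure_mono)
    show "{\<omega> \<in> space M. \<exists>k\<le>n. \<epsilon> \<le> \<bar>\<Sum>i<k. X i \<omega>\<bar>} \<subseteq> {\<omega> \<in> space M. \<epsilon>\<^sup>2 \<le> (T n \<omega>)\<^sup>2}"
    proof safe
      fix \<omega> k assume "k \<le> n" "\<epsilon> \<le> \<bar>\<Sum>i<k. X i \<omega>\<bar>"
      then have "\<epsilon> \<le> \<bar>T n \<omega>\<bar>"
        using stopped_sum_cases[of n \<epsilon> "\<lambda>i. X i \<omega>"] by (auto simp: T_def split: if_splits)
      then show "\<epsilon>\<^sup>2 \<le> (T n \<omega>)\<^sup>2" using \<epsilon> by (simp add: abs_le_square_iff[symmetric])
    qed
  qed measurable
  also have "\<dots> \<le> expectation (\<lambda>\<omega>. (T n \<omega>)\<^sup>2) / \<epsilon>\<^sup>2"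
    using \<epsilon> main by (intro integral_Markov_inequality_measure[where A = "{}"]) auto
  also have "\<dots> \<le> (\<Sum>i<n. expectation (\<lambda>\<omega>. (X i \<omega>)\<^sup>2)) / \<epsilon>\<^sup>2"
    using main by (intro divide_right_mono) auto
  finally show ?thesis .
qed

text \<open>The maximal inequality for the sequence shifted by \<open>N\<close> bounds the chance of
  a later oscillation of size \<epsilon> by a tail of the variance series. Letting \<epsilon> run
  through \<open>1 / Suc p\<close> makes the partial sums Cauchy outside a countable union of null
  sets.\<close>

theorem AE_summable_indep_vars:
  fixes X :: "nat \<Rightarrow> 'a \<Rightarrow> real"
  assumes indep: "indep_vars (\<lambda>_. borel) X UNIV"
    and sq: "\<And>i. integrable M (\<lambda>\<omega>. (X i \<omega>)\<^sup>2)"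
    and mean: "\<And>i. expectation (X i) = 0"
    and summ: "summable (\<lambda>i. expectation (\<lambda>\<omega>. (X i \<omega>)\<^sup>2))"
  shows "AE \<omega> in M. summable (\<lambda>i. X i \<omega>)"
proof -
  define v where "v i = expectation (\<lambda>\<omega>. (X i \<omega>)\<^sup>2)" for i
  have v0: "0 \<le> v i" for i by (simp add: v_def)
  have [measurable]: "random_variable borel (X i)" for i
    using indep by (simp add: indep_vars_def)
  have tail: "(\<lambda>N. \<Sum>i. v (i + N)) \<longlonglongrightarrow> 0"
    using suminf_exist_split2[of v] summ by (simp add: v_def[abs_def])
  have "AE \<omega> in M. \<exists>N. \<forall>k. \<bar>\<Sum>i<k. X (N + i) \<omega>\<bar> < \<epsilon>" if \<epsilon>: "0 < \<epsilon>" for \<epsilon>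
  proof -
    define E where "E N n = {\<omega> \<in> space M. \<exists>k\<le>n. \<epsilon> \<le> \<bar>\<Sum>i<k. X (N + i) \<omega>\<bar>}" for N n
    have [measurable]: "E N n \<in> sets M" for N n unfolding E_def by measurable
    have le: "prob (E N n) \<le> (\<Sum>i. v (i + N)) / \<epsilon>\<^sup>2" for N n
    proof -
      have "prob (E N n) \<le> (\<Sum>i<n. v (N + i)) / \<epsilon>\<^sup>2"
        unfolding E_def v_def
        by (intro kolmogorov_maximal_inequality \<epsilon> sq mean indep_vars_reindex[OF indep]) auto
      also have "(\<Sum>i<n. v (N + i)) \<le> (\<Sum>i. v (i + N))"
        using summable_ignore_initial_segment[OF summ, of N] v0
        by (subst add.commute, intro sum_le_suminf) (auto simp: v_def)
      finally show ?thesis by (simp add: divide_right_mono)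
    qed
    \<comment> \<open>The events increase with \<open>n\<close>, so continuity of the measure
      removes the finite horizon.\<close>
    have le': "prob (\<Union>n. E N n) \<le> (\<Sum>i. v (i + N)) / \<epsilon>\<^sup>2" for N
    proof (rule LIMSEQ_le_const2)
      show "(\<lambda>n. prob (E N n)) \<longlonglongrightarrow> prob (\<Union>n. E N n)"
        by (rule finite_Lim_measure_incseq)
          (auto simp: E_def incseq_def intro: order_trans)
    qed (use le in auto)
    have "prob (\<Inter>N. \<Union>n. E N n) \<le> 0"
    proof (rule LIMSEQ_le_const)
      show "(\<lambda>N. (\<Sum>i. v (i + N)) / \<epsilon>\<^sup>2) \<longlonglongrightarrow> 0"
        using tendsto_divide[OF tail tendsto_const[of "\<epsilon>\<^sup>2"]] \<epsilon> by simp
      show "\<exists>N. \<forall>n\<ge>N. prob (\<Inter>N. \<Union>n. E N n) \<le> (\<Sum>i. v (i + n)) / \<epsilon>\<^sup>2"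
        by (intro exI allI impI order_trans[OF _ le'] finite_measure_mono) auto
    qed
    then have "prob (\<Inter>N. \<Union>n. E N n) = 0"
      by (simp add: measure_le_0_iff)
    then have "AE \<omega> in M. \<omega> \<notin> (\<Inter>N. \<Union>n. E N n)"
      by (intro AE_not_in) (auto simp: null_sets_def emeasure_eq_measure)
    then show ?thesis
      by (rule AE_mp) (auto simp: E_def not_le intro!: AE_I2)
  qed
  then have "AE \<omega> in M. \<forall>p::nat. \<exists>N. \<forall>k. \<bar>\<Sum>i<k. X (N + i) \<omega>\<bar> < 1 / real (Suc p)"
    by (subst AE_all_countable) simp
  then show ?thesis
  proof (rule AE_mp, intro AE_I2 impI)
    fix \<omega> assume *: "\<forall>p::nat. \<exists>N. \<forall>k. \<bar>\<Sum>i<k. X (N + i) \<omega>\<bar> < 1 / real (Suc p)"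
    show "summable (\<lambda>i. X i \<omega>)"
      unfolding summable_Cauchy
    proof (intro allI impI)
      fix e :: real assume "0 < e"
      \<comment> \<open>The tolerance is halved because a sum over \<open>m..<n\<close> is a
        difference of two sums that start at \<open>N\<close>.\<close>
      then obtain p where p: "1 / real (Suc p) < e / 2"
        using nat_approx_posE[of "e / 2"] by auto
      from * obtain N where N: "\<bar>\<Sum>i<k. X (N + i) \<omega>\<bar> < 1 / real (Suc p)" for k by blast
      show "\<exists>N. \<forall>m\<ge>N. \<forall>n. norm (\<Sum>i = m..<n. X i \<omega>) < e"
      proof (intro exI[of _ N] allI impI)
        fix m n assume m: "N \<le> m"
        have eq: "(\<Sum>i<k. X (N + i) \<omega>) = (\<Sum>i = N..<N + k. X i \<omega>)" for k
          using sum.shift_bounds_nat_ivl[of "\<lambda>i. X i \<omega>" 0 N k]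
          by (simp add: add.commute atLeast0LessThan)
        show "norm (\<Sum>i = m..<n. X i \<omega>) < e"
        proof (cases "m \<le> n")
          case True
          have "(\<Sum>i = m..<n. X i \<omega>) = (\<Sum>i<n - N. X (N + i) \<omega>) - (\<Sum>i<m - N. X (N + i) \<omega>)"
            unfolding eq using m True sum.atLeastLessThan_concat[of N m n "\<lambda>i. X i \<omega>"] by simp
          then show ?thesis using N[of "n - N"] N[of "m - N"] p unfolding real_norm_def by linarith
        qed (use \<open>0 < e\<close> in auto)
      qed
    qed
  qed
qed

end

subsection \<open>Exponential moments of sums of normal squares\<close>

context prob_space
begin

text \<open>Multiplying the density by \<open>exp (t * x^2)\<close> gives \<open>1 / sqrt q\<close>
  times another centred normal density, of variance \<open>\<sigma>^2 / q\<close> with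
  \<open>q = 1 - 2 * t * \<sigma>^2\<close>. Negative \<open>t\<close> is allowed and serves for
  lower bounds.\<close>

lemma nn_integral_exp_square_normal:
  assumes Y: "distributed M lborel Y (normal_density 0 \<sigma>)" and \<sigma>: "0 < \<sigma>" and t: "2 * t * \<sigma>\<^sup>2 < 1"
  shows "(\<integral>\<^sup>+\<omega>. ennreal (exp (t * (Y \<omega>)\<^sup>2)) \<partial>M) = ennreal (1 / sqrt (1 - 2 * t * \<sigma>\<^sup>2))"
proof -
  define q where "q = 1 - 2 * t * \<sigma>\<^sup>2"
  have q: "0 < q" using t by (simp add: q_def)
  have eq: "normal_density 0 \<sigma> x * exp (t * x\<^sup>2) = 1 / sqrt q * normal_density 0 (\<sigma> / sqrt q) x" for x
  proof -
    have "- x\<^sup>2 / (2 * \<sigma>\<^sup>2) + t * x\<^sup>2 = - x\<^sup>2 / (2 * (\<sigma> / sqrt q)\<^sup>2)"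
      using \<sigma> q by (simp add: q_def field_simps)
    then have "exp (- x\<^sup>2 / (2 * \<sigma>\<^sup>2)) * exp (t * x\<^sup>2) = exp (- x\<^sup>2 / (2 * (\<sigma> / sqrt q)\<^sup>2))"
      by (simp add: exp_add[symmetric])
    moreover have "1 / sqrt (2 * pi * \<sigma>\<^sup>2) = 1 / sqrt q * (1 / sqrt (2 * pi * (\<sigma> / sqrt q)\<^sup>2))"
      using \<sigma> q by (simp add: power_divide real_sqrt_mult real_sqrt_divide)
    ultimately show ?thesis unfolding normal_density_def by simp
  qed
  have "(\<integral>\<^sup>+\<omega>. ennreal (exp (t * (Y \<omega>)\<^sup>2)) \<partial>M)
      = (\<integral>\<^sup>+x. ennreal (normal_density 0 \<sigma> x) * ennreal (exp (t * x\<^sup>2)) \<partial>lborel)"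
    by (rule distributed_nn_integral[OF Y, symmetric]) measurable
  also have "\<dots> = (\<integral>\<^sup>+x. ennreal (1 / sqrt q) * ennreal (normal_density 0 (\<sigma> / sqrt q) x) \<partial>lborel)"
    using eq q by (intro nn_integral_cong) (simp add: ennreal_mult[symmetric])
  also have "\<dots> = ennreal (1 / sqrt q) * (\<integral>\<^sup>+x. ennreal (normal_density 0 (\<sigma> / sqrt q) x) \<partial>lborel)"
    by (rule nn_integral_cmult) measurable
  also have "(\<integral>\<^sup>+x. ennreal (normal_density 0 (\<sigma> / sqrt q) x) \<partial>lborel) = 1"
    using \<sigma> q by (subst nn_integral_eq_integral) simp_all
  finally show ?thesis by (simp add: q_def)
qed

lemma nn_integral_exp_sum_squares:
  fixes Y :: "'i \<Rightarrow> 'a \<Rightarrow> real"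
  assumes "finite K" and indep: "indep_vars (\<lambda>_. borel) Y K"
  shows "(\<integral>\<^sup>+\<omega>. ennreal (exp (t * (\<Sum>k\<in>K. (Y k \<omega>)\<^sup>2))) \<partial>M)
    = (\<Prod>k\<in>K. \<integral>\<^sup>+\<omega>. ennreal (exp (t * (Y k \<omega>)\<^sup>2)) \<partial>M)"
proof -
  have "(\<integral>\<^sup>+\<omega>. ennreal (exp (t * (\<Sum>k\<in>K. (Y k \<omega>)\<^sup>2))) \<partial>M)
      = (\<integral>\<^sup>+\<omega>. (\<Prod>k\<in>K. ennreal (exp (t * (Y k \<omega>)\<^sup>2))) \<partial>M)"
    using \<open>finite K\<close> by (simp add: sum_distrib_left exp_sum prod_ennreal)
  also have "\<dots> = (\<Prod>k\<in>K. \<integral>\<^sup>+\<omega>. ennreal (exp (t * (Y k \<omega>)\<^sup>2)) \<partial>M)"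
    by (intro indep_vars_nn_integral \<open>finite K\<close> indep_vars_compose2[OF indep]) auto
  finally show ?thesis .
qed

lemma indep_vars_sum_blocks:
  fixes X :: "'i \<Rightarrow> 'a \<Rightarrow> real"
  assumes indep: "indep_vars (\<lambda>_. borel) X I" and J: "\<And>k. k \<in> K \<Longrightarrow> J k \<subseteq> I"
    and disj: "disjoint_family_on J K"
  shows "indep_vars (\<lambda>_. borel) (\<lambda>k \<omega>. \<Sum>j\<in>J k. u k j * X j \<omega>) K"
proof -
  have "indep_vars (\<lambda>_. borel) (\<lambda>k \<omega>. \<Sum>j\<in>J k. u k j * restrict (\<lambda>i. X i \<omega>) (J k) j) K"
    by (rule indep_vars_compose2[OF indep_vars_restrict[OF indep J disj],
        where Y = "\<lambda>k f. \<Sum>j\<in>J k. u k j * f j"]) (auto intro!: borel_measurable_sum)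
  also have "(\<lambda>k \<omega>. \<Sum>j\<in>J k. u k j * restrict (\<lambda>i. X i \<omega>) (J k) j) = (\<lambda>k \<omega>. \<Sum>j\<in>J k. u k j * X j \<omega>)"
    by (intro ext sum.cong) auto
  finally show ?thesis .
qed

text \<open>Each block sum is a centred normal of variance \<open>s\<close> with
  \<open>s \<le> v\<close>. The exponent \<open>1 / (4 * v)\<close> keeps
  \<open>1 - 2 * t * s\<close> at least 1/2, so every factor of the product is at most
  \<open>sqrt 2\<close>. Nonempty blocks and nonzero weights keep \<open>s\<close> positive, so that
  the normal density is genuine.\<close>

lemma nn_integral_exp_sum_squares_blocks_le:
  fixes Z :: "'i \<Rightarrow> 'a \<Rightarrow> real"
  assumes indep: "indep_vars (\<lambda>_. borel) Z I"
    and Z: "\<And>i. i \<in> I \<Longrightarrow> distributed M lborel (Z i) (\<lambda>x. ennreal (std_normal_density x))"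
    and K: "finite K"
    and J: "\<And>k. k \<in> K \<Longrightarrow> J k \<subseteq> I" "\<And>k. k \<in> K \<Longrightarrow> finite (J k)" "\<And>k. k \<in> K \<Longrightarrow> J k \<noteq> {}"
    and disj: "disjoint_family_on J K"
    and u: "\<And>k j. k \<in> K \<Longrightarrow> j \<in> J k \<Longrightarrow> u k j \<noteq> 0"
    and v: "\<And>k. k \<in> K \<Longrightarrow> (\<Sum>j\<in>J k. (u k j)\<^sup>2) \<le> v"
  shows "(\<integral>\<^sup>+\<omega>. ennreal (exp ((\<Sum>k\<in>K. (\<Sum>j\<in>J k. u k j * Z j \<omega>)\<^sup>2) / (4 * v))) \<partial>M) \<le> ennreal (sqrt 2 ^ card K)"
proof -
  have "(\<integral>\<^sup>+\<omega>. ennreal (exp (1 / (4 * v) * (\<Sum>k\<in>K. (\<Sum>j\<in>J k. u k j * Z j \<omega>)\<^sup>2))) \<partial>M)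
    = (\<Prod>k\<in>K. \<integral>\<^sup>+\<omega>. ennreal (exp (1 / (4 * v) * (\<Sum>j\<in>J k. u k j * Z j \<omega>)\<^sup>2)) \<partial>M)"
    by (intro nn_integral_exp_sum_squares K indep_vars_sum_blocks[OF indep] J disj) auto
  also have "\<dots> \<le> (\<Prod>k\<in>K. ennreal (sqrt 2))"
  proof (intro prod_mono_ennreal)
    fix k assume k: "k \<in> K"
    define s where "s = (\<Sum>j\<in>J k. (u k j)\<^sup>2)"
    have s: "0 < s" unfolding s_def using J(2,3)[OF k] u[OF k] by (intro sum_pos) auto
    have sv: "s \<le> v" using v[OF k] by (simp add: s_def)
    have "distributed M lborel (\<lambda>\<omega>. \<Sum>j\<in>J k. u k j * Z j \<omega>)
        (normal_density (\<Sum>j\<in>J k. 0) (sqrt (\<Sum>j\<in>J k. \<bar>u k j\<bar>\<^sup>2)))"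
    proof (rule sum_indep_normal)
      show "indep_vars (\<lambda>_. borel) (\<lambda>j \<omega>. u k j * Z j \<omega>) (J k)"
        by (rule indep_vars_compose2[OF indep_vars_subset[OF indep J(1)[OF k]]]) measurable
      fix j assume j: "j \<in> J k"
      then show "0 < \<bar>u k j\<bar>" using u[OF k j] by simp
      from j J(1)[OF k] show "distributed M lborel (\<lambda>\<omega>. u k j * Z j \<omega>) (normal_density 0 \<bar>u k j\<bar>)"
        using normal_density_affine[OF Z[of j], of "u k j" 0] u[OF k j] by (auto simp: subset_iff)
    qed (use J(2,3)[OF k] in auto)
    then have "(\<integral>\<^sup>+\<omega>. ennreal (exp (1 / (4 * v) * (\<Sum>j\<in>J k. u k j * Z j \<omega>)\<^sup>2)) \<partial>M)
        = ennreal (1 / sqrt (1 - 2 * (1 / (4 * v)) * (sqrt s)\<^sup>2))"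
      using s sv by (intro nn_integral_exp_square_normal) (auto simp: s_def[symmetric] field_simps)
    also have "\<dots> \<le> ennreal (sqrt 2)"
    proof (rule ennreal_leI)
      have "1 / sqrt (1 - 2 * (1 / (4 * v)) * (sqrt s)\<^sup>2) \<le> 1 / sqrt (1 / 2)"
        using s sv by (intro divide_left_mono real_sqrt_le_mono mult_pos_pos) (auto simp: field_simps)
      then show "1 / sqrt (1 - 2 * (1 / (4 * v)) * (sqrt s)\<^sup>2) \<le> sqrt 2"
        by (simp add: real_sqrt_divide)
    qed
    finally show "(\<integral>\<^sup>+\<omega>. ennreal (exp (1 / (4 * v) * (\<Sum>j\<in>J k. u k j * Z j \<omega>)\<^sup>2)) \<partial>M) \<le> ennreal (sqrt 2)" .
  qed
  also have "\<dots> = ennreal (sqrt 2 ^ card K)" by (simp add: ennreal_power)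
  finally show ?thesis by simp
qed

text \<open>Chernoff's bound: Markov's inequality applied to \<open>exp Q\<close>.\<close>

lemma prob_ge_le_exp_moment:
  fixes Q :: "'a \<Rightarrow> real"
  assumes [measurable]: "random_variable borel Q"
    and le: "(\<integral>\<^sup>+\<omega>. ennreal (exp (Q \<omega>)) \<partial>M) \<le> ennreal b" and "0 \<le> b"
  shows "prob {\<omega> \<in> space M. a \<le> Q \<omega>} \<le> b * exp (- a)"
proof -
  have "emeasure M {\<omega> \<in> space M. 1 \<le> ennreal (exp (- a)) * ennreal (exp (Q \<omega>))}
      \<le> ennreal (exp (- a)) * (\<integral>\<^sup>+\<omega>. ennreal (exp (Q \<omega>)) * indicator (space M) \<omega> \<partial>M)"
    by (rule nn_integral_Markov_inequality) measurable
  also have "(\<integral>\<^sup>+\<omega>. ennreal (exp (Q \<omega>)) * indicator (space M) \<omega> \<partial>M) = (\<integral>\<^sup>+\<omega>. ennreal (exp (Q \<omega>)) \<partial>M)"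
    by (intro nn_integral_cong) simp
  also have "ennreal (exp (- a)) * \<dots> \<le> ennreal (exp (- a)) * ennreal b"
    by (rule mult_left_mono[OF le]) simp
  also have "\<dots> = ennreal (b * exp (- a))"
    using \<open>0 \<le> b\<close> by (simp add: ennreal_mult[symmetric] mult.commute)
  also have "{\<omega> \<in> space M. 1 \<le> ennreal (exp (- a)) * ennreal (exp (Q \<omega>))} = {\<omega> \<in> space M. a \<le> Q \<omega>}"
    by (auto simp: ennreal_mult[symmetric] exp_add[symmetric] ennreal_ge_1)
  finally show ?thesis
    using \<open>0 \<le> b\<close> by (simp add: emeasure_eq_measure)
qed

text \<open>Chernoff's bound at level \<open>a * n\<close> yields the geometric bound
  \<open>(b / exp a)^n\<close>, and Borel-Cantelli applies. The slope \<open>a\<close> may be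
  negative, which turns lower bounds for a sum of squares into upper bounds for its
  negative.\<close>

lemma AE_eventually_less_exp_moment:
  fixes Q :: "nat \<Rightarrow> 'a \<Rightarrow> real"
  assumes [measurable]: "\<And>n. random_variable borel (Q n)"
    and le: "\<And>n. N \<le> n \<Longrightarrow> (\<integral>\<^sup>+\<omega>. ennreal (exp (Q n \<omega>)) \<partial>M) \<le> ennreal (b ^ n)"
    and b: "0 < b" "b < exp a"
  shows "AE \<omega> in M. \<forall>\<^sub>F n in sequentially. Q n \<omega> < a * real n"
proof -
  define A where "A n = {\<omega> \<in> space M. a * real n \<le> Q n \<omega>}" for n
  have le_geo: "prob (A n) \<le> (b / exp a) ^ n" if "N \<le> n" for n
  proof -
    have "exp (- (a * real n)) = 1 / exp a ^ n"
      by (simp only: exp_minus exp_of_nat2_mult divide_inverse mult_1)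
    then show ?thesis
      using prob_ge_le_exp_moment[OF _ le[OF that], of "a * real n"] b(1)
      by (simp add: A_def power_divide)
  qed
  have geo: "summable (\<lambda>n. (b / exp a) ^ n)"
    using b by (intro summable_geometric) simp
  have summ: "summable (\<lambda>n. prob (A n))"
    by (rule summable_comparison_test'[OF geo, of N]) (simp add: le_geo)
  have [measurable]: "A n \<in> sets M" for n
    unfolding A_def by measurable
  have "AE \<omega> in M. \<forall>\<^sub>F n in sequentially. \<omega> \<in> space M - A n"
    by (rule borel_cantelli_AE1[OF _ _ summ]) (simp_all add: emeasure_eq_measure)
  then show ?thesis
    by (rule AE_mp) (auto simp: A_def not_le elim: eventually_mono)
qed

end

subsection \<open>From dyadic blocks to polished tails\<close>

text \<open>The tail is covered by blocks starting at \<open>2^m * k\<close>, whose bounds form a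
  geometric series of ratio \<open>2 powr - \<beta>\<close>; the new constant is its sum.\<close>

lemma tail_le_of_dyadic_blocks:
  fixes x :: "nat \<Rightarrow> real" and \<beta> B :: real
  assumes x: "\<And>j. 0 \<le> x j" and \<beta>: "0 < \<beta>" and k0: "1 \<le> k0"
    and le: "\<And>k. k0 \<le> k \<Longrightarrow> (\<Sum>j = k..<2 * k. x j) \<le> B * real k powr - \<beta>"
    and k: "k0 \<le> k"
  shows "summable x" and "(\<Sum>j. x (k + j)) \<le> B / (1 - 2 powr - \<beta>) * real k powr - \<beta>"
proof -
  define C where "C = B / (1 - 2 powr - \<beta>)"
  have q: "2 powr - \<beta> < (1 :: real)" using \<beta> by (simp add: powr_less_one)
  \<comment> \<open>The sign of \<open>B\<close> is not assumed; it follows from a block sum being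
    nonnegative.\<close>
  have "0 \<le> B * real k powr - \<beta>"
    using le[OF k] x by (meson order_trans sum_nonneg)
  then have "0 \<le> B" using k k0 by (simp add: zero_le_mult_iff)
  then have C: "0 \<le> C" using q by (simp add: C_def)
  have "C * (1 - 2 powr - \<beta>) = B" using q \<beta> by (simp add: C_def)
  \<comment> \<open>\<open>C\<close> is the fixed point of adding one block and doubling the
    starting index, which lets the induction close with the same constant.\<close>
  then have step: "B + C * 2 powr - \<beta> = C" by (simp add: right_diff_distrib)
  have block: "(\<Sum>j = k..<2 ^ m * k. x j) \<le> C * real k powr - \<beta>" if "k0 \<le> k" for m k
    using that
  proof (induction m arbitrary: k)
    \<comment> \<open>The first block is split off and the induction hypothesis is applied at
      \<open>2 * k\<close>; hence the generalisation over \<open>k\<close>.\<close>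
    case (Suc m)
    have "(\<Sum>j = k..<2 ^ Suc m * k. x j) = (\<Sum>j = k..<2 * k. x j) + (\<Sum>j = 2 * k..<2 ^ m * (2 * k). x j)"
      using sum.atLeastLessThan_concat[of k "2 * k" "2 ^ m * (2 * k)" x]
      by (simp add: mult.left_commute mult.assoc)
    also have "\<dots> \<le> B * real k powr - \<beta> + C * real (2 * k) powr - \<beta>"
      using Suc.prems by (intro add_mono le Suc.IH) auto
    also have "\<dots> = (B + C * 2 powr - \<beta>) * real k powr - \<beta>"
      by (simp add: powr_mult algebra_simps)
    finally show ?case by (simp add: step)
  qed (use C in auto)
  have part: "(\<Sum>j<n. x (k + j)) \<le> C * real k powr - \<beta>" for n
  proof -
    have "k + n \<le> k + n * k" using k k0 by simp
    also have "\<dots> = Suc n * k" by simp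
    also have "\<dots> \<le> 2 ^ n * k"
      using less_exp[of n] by (intro mult_le_mono1) (rule Suc_leI)
    finally have "k + n \<le> 2 ^ n * k" .
    have "(\<Sum>j<n. x (k + j)) = (\<Sum>j = k..<k + n. x j)"
      using sum.shift_bounds_nat_ivl[of x 0 k n] by (simp add: add.commute atLeast0LessThan)
    also have "\<dots> \<le> (\<Sum>j = k..<2 ^ n * k. x j)"
      using \<open>k + n \<le> 2 ^ n * k\<close> x by (intro sum_mono2) auto
    finally show ?thesis using block[OF k, of n] by linarith
  qed
  have "summable (\<lambda>j. x (k + j))"
    by (rule summableI_nonneg_bounded[OF x part])
  then show "summable x" using summable_iff_shift[of x k] by (simp add: add.commute)
  show "(\<Sum>j. x (k + j)) \<le> B / (1 - 2 powr - \<beta>) * real k powr - \<beta>"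
    using suminf_le_const[OF \<open>summable (\<lambda>j. x (k + j))\<close> part] by (simp add: C_def)
qed

lemma eventually_tail_le_of_dyadic_blocks:
  fixes x :: "nat \<Rightarrow> real" and \<beta> B :: real
  assumes x: "\<And>j. 0 \<le> x j" and \<beta>: "0 < \<beta>"
    and le: "\<forall>\<^sub>F k in sequentially. (\<Sum>j = k..<2 * k. x j) \<le> B * real k powr - \<beta>"
  obtains C where "0 < C" "summable x" "\<forall>\<^sub>F k in sequentially. (\<Sum>j. x (k + j)) \<le> C * real k powr - \<beta>"
proof -
  from le obtain k0 where k0: "\<And>k. k0 \<le> k \<Longrightarrow> (\<Sum>j = k..<2 * k. x j) \<le> B * real k powr - \<beta>"
    by (auto simp: eventually_sequentially)
  \<comment> \<open>The absolute value and the added 1 ensure strict positivity.\<close>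
  define C where "C = \<bar>B / (1 - 2 powr - \<beta>)\<bar> + 1"
  define k1 where "k1 = max 1 k0"
  have k1: "1 \<le> k1" "\<And>k. k1 \<le> k \<Longrightarrow> (\<Sum>j = k..<2 * k. x j) \<le> B * real k powr - \<beta>"
    using k0 by (simp_all add: k1_def)
  note tail = tail_le_of_dyadic_blocks[OF x \<beta> k1]
  have "summable x" by (rule tail(1)[OF _ order_refl])
  moreover have "(\<Sum>j. x (k + j)) \<le> C * real k powr - \<beta>" if "k1 \<le> k" for k
  proof -
    have "(\<Sum>j. x (k + j)) \<le> B / (1 - 2 powr - \<beta>) * real k powr - \<beta>"
      by (rule tail(2)[OF _ that])
    also have "\<dots> \<le> C * real k powr - \<beta>"
      unfolding C_def by (intro mult_right_mono) (linarith, simp)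
    finally show ?thesis .
  qed
  then have "\<forall>\<^sub>F k in sequentially. (\<Sum>j. x (k + j)) \<le> C * real k powr - \<beta>"
    unfolding eventually_sequentially by blast
  moreover have "0 < C" unfolding C_def by linarith
  ultimately show ?thesis using that by blast
qed

text \<open>The whole tail and its first dyadic block have the same order
  \<open>k powr - \<beta>\<close>, so \<rho> = 2 and \<open>L = C / b\<close> work.\<close>

lemma polished_tail_coeffs_of_dyadic_blocks:
  fixes c :: "nat \<Rightarrow> real" and \<beta> b B :: real
  assumes \<beta>: "0 < \<beta>" and b: "0 < b"
    and upper: "\<forall>\<^sub>F k in sequentially. (\<Sum>j = k..<2 * k. (c j)\<^sup>2) \<le> B * real k powr - \<beta>"
    and lower: "\<forall>\<^sub>F k in sequentially. b * real k powr - \<beta> \<le> (\<Sum>j = k..<2 * k. (c j)\<^sup>2)"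
  shows "polished_tail_coeffs c"
proof -
  obtain C where C: "0 < C" "summable (\<lambda>j. (c j)\<^sup>2)"
    "\<forall>\<^sub>F k in sequentially. (\<Sum>j. (c (k + j))\<^sup>2) \<le> C * real k powr - \<beta>"
    using eventually_tail_le_of_dyadic_blocks[OF _ \<beta> upper] by auto
  have "\<forall>\<^sub>F k in sequentially. (\<Sum>j. (c (k + j))\<^sup>2) \<le> C / b * (\<Sum>j = k..nat \<lfloor>2 * real k\<rfloor>. (c j)\<^sup>2)"
    using C(3) lower
  proof eventually_elim
    case (elim k)
    have "nat \<lfloor>2 * real k\<rfloor> = 2 * k" by linarith
    have "C * real k powr - \<beta> = C / b * (b * real k powr - \<beta>)" using b by simp
    also have "\<dots> \<le> C / b * (\<Sum>j = k..<2 * k. (c j)\<^sup>2)"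
      using elim C b by (intro mult_left_mono) auto
    also have "\<dots> \<le> C / b * (\<Sum>j = k..2 * k. (c j)\<^sup>2)"
      using C b by (intro mult_left_mono sum_mono2) auto
    finally show ?case using elim(1) unfolding \<open>nat \<lfloor>2 * real k\<rfloor> = 2 * k\<close> by linarith
  qed
  then show ?thesis
    unfolding polished_tail_coeffs_def using C b by (intro conjI exI[of _ "C / b"] exI[of _ 2]) auto
qed

text \<open>Subtracting \<open>c i\<close> removes the positive half of the term
  \<open>l = 0\<close>. For \<open>i\<close> in \<open>{1..n}\<close> the indices left are
  \<open>2*n+2-i\<close> and larger ones, so all exceed \<open>n\<close>.\<close>

definition aliasing_remainder :: "(nat \<Rightarrow> real) \<Rightarrow> nat \<Rightarrow> nat \<Rightarrow> real" where
  "aliasing_remainder c n i = (\<Sum>l. aliasing_term c n i l) - c i"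

text \<open>With \<open>y = c + r\<close>, the bound \<open>y^2 \<le> 2 c^2 + 2 r^2\<close> controls
  the left side and \<open>c^2 / 2 - r^2 \<le> y^2\<close> the right side. For
  \<open>n > p * k\<close> the remainder costs at most half of what the second bound retains of the
  block of \<open>c\<close>; for smaller \<open>n\<close> both sides are the same sum.\<close>

lemma discrete_polished_tail_coeffs_of_dyadic_blocks:
  fixes c :: "nat \<Rightarrow> real" and \<beta> b B D :: real
  assumes \<beta>: "0 < \<beta>" and b: "0 < b" and D: "0 \<le> D"
    and upper: "\<forall>\<^sub>F k in sequentially. (\<Sum>j = k..<2 * k. (c j)\<^sup>2) \<le> B * real k powr - \<beta>"
    and lower: "\<forall>\<^sub>F k in sequentially. b * real k powr - \<beta> \<le> (\<Sum>j = k..<2 * k. (c j)\<^sup>2)"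
    and summ: "\<And>n i. 1 \<le> n \<Longrightarrow> i \<in> {1..n} \<Longrightarrow> summable (aliasing_term c n i)"
    and remainder: "\<forall>\<^sub>F n in sequentially. (\<Sum>i = 1..n. (aliasing_remainder c n i)\<^sup>2) \<le> D * real n powr - \<beta>"
  shows "discrete_polished_tail_coeffs c"
proof -
  obtain C where C: "0 < C" "summable (\<lambda>j. (c j)\<^sup>2)"
    "\<forall>\<^sub>F k in sequentially. (\<Sum>j. (c (k + j))\<^sup>2) \<le> C * real k powr - \<beta>"
    using eventually_tail_le_of_dyadic_blocks[OF _ \<beta> upper] by auto
  have "((\<lambda>p. D * real p powr - \<beta>) \<longlongrightarrow> D * 0) sequentially"
    using \<beta> by (intro tendsto_intros tendsto_neg_powr filterlim_real_sequentially) auto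
  then have "\<forall>\<^sub>F p in sequentially. D * real p powr - \<beta> < b / 4"
    using b by (intro order_tendstoD(2)) auto
  then have "\<forall>\<^sub>F p in sequentially. D * real p powr - \<beta> < b / 4 \<and> 2 \<le> p"
    by (intro eventually_conj eventually_ge_at_top)
  \<comment> \<open>Halving \<open>b\<close> and losing less than \<open>b / 4\<close> to the
    remainder leaves \<open>b / 4\<close>. The condition \<open>2 \<le> p\<close> places the block
    \<open>k..<2 * k\<close> inside \<open>k..p * k\<close>.\<close>
  then obtain p where p: "D * real p powr - \<beta> < b / 4" "2 \<le> p"
    by (auto simp: eventually_sequentially)
  \<comment> \<open>The 1 settles the case \<open>n \<le> p * k\<close>; the quotient compares the
    upper constant \<open>2 * (C + D)\<close> with the lower constant \<open>b / 4\<close>.\<close>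
  define L where "L = max 1 (2 * (C + D) / (b / 4))"
  have L: "1 \<le> L" "2 * (C + D) \<le> L * (b / 4)"
    using b by (auto simp: L_def field_simps max_def)
  define y where "y n i = c i + aliasing_remainder c n i" for n i
  have disc: "(discrete_coeff c n i)\<^sup>2 = (real n + 1/2) * (y n i)\<^sup>2" for n i
    by (simp add: discrete_coeff_def y_def aliasing_remainder_def power_mult_distrib)
  from remainder obtain n0 where
    n0: "\<And>n. n0 \<le> n \<Longrightarrow> (\<Sum>i = 1..n. (aliasing_remainder c n i)\<^sup>2) \<le> D * real n powr - \<beta>"
    by (auto simp: eventually_sequentially)
  have "\<forall>\<^sub>F k in sequentially. \<forall>n\<ge>k.
      (\<Sum>i = k..n. (y n i)\<^sup>2) \<le> L * (\<Sum>i = k..min (p * k) n. (y n i)\<^sup>2)"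
    using C(3) lower eventually_ge_at_top[of "max 1 n0"]
  proof eventually_elim
    case (elim k)
    show ?case
    proof (intro allI impI)
      fix n assume "k \<le> n"
      define r where "r i = aliasing_remainder c n i" for i
      have k: "1 \<le> k" "n0 \<le> k" "k \<le> n" using elim \<open>k \<le> n\<close> by auto
      have rle: "(\<Sum>i\<in>A. (r i)\<^sup>2) \<le> D * real n powr - \<beta>" if "A \<subseteq> {1..n}" for A
        using n0[of n] k sum_mono2[OF _ that, of "\<lambda>i. (r i)\<^sup>2"] by (auto simp: r_def)
      show "(\<Sum>i = k..n. (y n i)\<^sup>2) \<le> L * (\<Sum>i = k..min (p * k) n. (y n i)\<^sup>2)"
      proof (cases "n \<le> p * k")
        case True
        have "0 \<le> (\<Sum>i = k..n. (y n i)\<^sup>2)" by (intro sum_nonneg) auto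
        with True L(1) show ?thesis
          by (simp add: min_absorb2 mult_le_cancel_right1)
      next
        case False
        have "(\<Sum>i = k..n. (y n i)\<^sup>2) \<le> (\<Sum>i = k..n. 2 * (c i)\<^sup>2 + 2 * (r i)\<^sup>2)"
        proof (intro sum_mono)
          fix i
          have "0 \<le> (c i - r i)\<^sup>2" by simp
          then show "(y n i)\<^sup>2 \<le> 2 * (c i)\<^sup>2 + 2 * (r i)\<^sup>2"
            unfolding y_def r_def power2_sum power2_diff by linarith
        qed
        also have "\<dots> = 2 * (\<Sum>i = k..n. (c i)\<^sup>2) + 2 * (\<Sum>i = k..n. (r i)\<^sup>2)"
          by (simp add: sum.distrib sum_distrib_left)
        also have "(\<Sum>i = k..n. (c i)\<^sup>2) \<le> (\<Sum>j. (c (k + j))\<^sup>2)"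
        proof -
          have "(\<Sum>i = k..n. (c i)\<^sup>2) = (\<Sum>j<Suc n - k. (c (k + j))\<^sup>2)"
            using k sum.shift_bounds_nat_ivl[of "\<lambda>i. (c i)\<^sup>2" 0 k "Suc n - k"]
            by (simp add: add.commute atLeast0LessThan atLeastLessThanSuc_atLeastAtMost)
          also have "\<dots> \<le> (\<Sum>j. (c (k + j))\<^sup>2)"
            using summable_ignore_initial_segment[OF C(2), of k]
            by (intro sum_le_suminf) (auto simp: add.commute)
          finally show ?thesis .
        qed
        also have "(\<Sum>j. (c (k + j))\<^sup>2) \<le> C * real k powr - \<beta>" by (rule elim)
        also have "(\<Sum>i = k..n. (r i)\<^sup>2) \<le> D * real n powr - \<beta>" using k by (intro rle) auto
        also have "D * real n powr - \<beta> \<le> D * real k powr - \<beta>"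
          using D k \<beta> by (intro mult_left_mono powr_mono2') auto
        finally have up: "(\<Sum>i = k..n. (y n i)\<^sup>2) \<le> 2 * (C + D) * real k powr - \<beta>"
          by (simp add: algebra_simps)
        have "D * real n powr - \<beta> \<le> D * real (p * k) powr - \<beta>"
          using D k p \<beta> False by (intro mult_left_mono powr_mono2') (auto simp del: of_nat_mult)
        also have "\<dots> = D * real p powr - \<beta> * real k powr - \<beta>"
          by (simp add: powr_mult)
        also have "\<dots> \<le> b / 4 * real k powr - \<beta>"
          using p by (intro mult_right_mono) auto
        finally have Dn: "D * real n powr - \<beta> \<le> b / 4 * real k powr - \<beta>" .
        have "2 * k \<le> p * k" using p(2) by (rule mult_le_mono1)
        then have "x < 2 * k \<Longrightarrow> x \<le> p * k" for x by linarith
        then have sub1: "{k..<2 * k} \<subseteq> {k..p * k}" by (simp add: subset_iff)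
        have sub2: "{k..p * k} \<subseteq> {1..n}" using k(1) False by (simp add: subset_iff)
        have r_sum: "(\<Sum>i = k..<2 * k. (r i)\<^sup>2) \<le> D * real n powr - \<beta>"
          by (rule rle[OF order_trans[OF sub1 sub2]])
        have "b / 4 * real k powr - \<beta> \<le> 1 / 2 * (b * real k powr - \<beta>) - D * real n powr - \<beta>"
          using Dn by simp
        also have "\<dots> \<le> 1 / 2 * (\<Sum>i = k..<2 * k. (c i)\<^sup>2) - (\<Sum>i = k..<2 * k. (r i)\<^sup>2)"
          using elim(2) r_sum by linarith
        also have "\<dots> = (\<Sum>i = k..<2 * k. (c i)\<^sup>2 / 2 - (r i)\<^sup>2)"
          by (simp add: sum_subtractf sum_divide_distrib)
        also have "\<dots> \<le> (\<Sum>i = k..<2 * k. (y n i)\<^sup>2)"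
        proof (intro sum_mono)
          fix i
          \<comment> \<open>The difference of the two sides of the claim is exactly this doubled
            square.\<close>
          have "0 \<le> (c i / 2 + r i)\<^sup>2 * 2" by simp
          then show "(c i)\<^sup>2 / 2 - (r i)\<^sup>2 \<le> (y n i)\<^sup>2"
            unfolding y_def r_def by (simp add: power2_eq_square algebra_simps)
        qed
        also have "\<dots> \<le> (\<Sum>i = k..p * k. (y n i)\<^sup>2)"
          by (rule sum_mono2[OF _ sub1]) auto
        finally have lo: "b / 4 * real k powr - \<beta> \<le> (\<Sum>i = k..p * k. (y n i)\<^sup>2)" .
        have "2 * (C + D) * real k powr - \<beta> \<le> L * (b / 4) * real k powr - \<beta>"
          using L(2) by (intro mult_right_mono) auto
        also have "\<dots> = L * (b / 4 * real k powr - \<beta>)" by simp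
        also have "\<dots> \<le> L * (\<Sum>i = k..p * k. (y n i)\<^sup>2)"
          using lo L(1) by (intro mult_left_mono) auto
        finally show ?thesis using up False by (simp add: min_absorb1)
      qed
    qed
  qed
  then have "\<forall>\<^sub>F k in sequentially. \<forall>n\<ge>k. (\<Sum>i = k..n. (discrete_coeff c n i)\<^sup>2)
      \<le> L * (\<Sum>i = k..min (nat \<lfloor>real p * real k\<rfloor>) n. (discrete_coeff c n i)\<^sup>2)"
  proof (rule eventually_mono, intro allI impI)
    fix k n :: nat
    assume "\<forall>n\<ge>k. (\<Sum>i = k..n. (y n i)\<^sup>2) \<le> L * (\<Sum>i = k..min (p * k) n. (y n i)\<^sup>2)" "k \<le> n"
    then have "(real n + 1/2) * (\<Sum>i = k..n. (y n i)\<^sup>2) \<le> (real n + 1/2) * (L * (\<Sum>i = k..min (p * k) n. (y n i)\<^sup>2))"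
      by (intro mult_left_mono) auto
    moreover have "nat \<lfloor>real p * real k\<rfloor> = p * k"
      by (simp only: of_nat_mult[symmetric] floor_of_nat nat_int)
    ultimately show "(\<Sum>i = k..n. (discrete_coeff c n i)\<^sup>2)
      \<le> L * (\<Sum>i = k..min (nat \<lfloor>real p * real k\<rfloor>) n. (discrete_coeff c n i)\<^sup>2)"
      by (simp only: disc sum_distrib_left[symmetric] mult.left_commute[of L])
  qed
  then show ?thesis
    unfolding discrete_polished_tail_coeffs_def using L(1) p(2) summ
    by (intro conjI exI[of _ L] exI[of _ "real p"]) auto
qed

subsection \<open>Convergent sine series\<close>

lemma has_integral_cos_int:
  fixes m :: int assumes "m \<noteq> 0"
  shows "((\<lambda>x. cos (real_of_int m * pi * x)) has_integral 0) {0..1}"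
proof -
  have "((\<lambda>x. cos (real_of_int m * pi * x)) has_integral
      (sin (real_of_int m * pi * 1) / (real_of_int m * pi) - sin (real_of_int m * pi * 0) / (real_of_int m * pi))) {0..1}"
    using assms
    by (intro fundamental_theorem_of_calculus)
       (auto intro!: derivative_eq_intros simp: has_real_derivative_iff_has_vector_derivative[symmetric])
  moreover have "sin (real_of_int m * pi) = 0"
    using sin_zero_iff_int2 by blast
  ultimately show ?thesis by simp
qed

text \<open>The half-integer shifts combine to integer frequencies, so orthonormality reduces to
  integrals of cosines with integer frequency.\<close>

lemma sine_basis_mult:
  "sine_basis i x * sine_basis j x
    = cos (real_of_int (int i - int j) * pi * x) - cos (real_of_int (int i + int j - 1) * pi * x)"
proof -
  have "sine_basis i x * sine_basis j x
      = 2 * (sin ((real i - 1/2) * pi * x) * sin ((real j - 1/2) * pi * x))"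
    by (simp add: sine_basis_def)
  also have "\<dots> = cos ((real i - 1/2) * pi * x - (real j - 1/2) * pi * x)
      - cos ((real i - 1/2) * pi * x + (real j - 1/2) * pi * x)"
    by (subst sin_times_sin) simp
  also have "(real i - 1/2) * pi * x - (real j - 1/2) * pi * x = real_of_int (int i - int j) * pi * x"
    by (simp add: algebra_simps)
  also have "(real i - 1/2) * pi * x + (real j - 1/2) * pi * x = real_of_int (int i + int j - 1) * pi * x"
    by (simp add: algebra_simps)
  finally show ?thesis .
qed

lemma continuous_on_sine_basis [continuous_intros]: "continuous_on A (sine_basis j)"
  unfolding sine_basis_def by (intro continuous_intros)

lemma borel_measurable_sine_basis [measurable]: "sine_basis j \<in> borel_measurable borel"
  by (rule borel_measurable_continuous_onI[OF continuous_on_sine_basis])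

lemma integrable_sine_basis_mult:
  "integrable (lebesgue_on {0..1}) (\<lambda>x. sine_basis i x * sine_basis j x)"
  by (rule continuous_imp_integrable_real) (intro continuous_intros)

lemma integral_sine_basis_mult:
  assumes "1 \<le> i" "1 \<le> j"
  shows "(\<integral>x. sine_basis i x * sine_basis j x \<partial>lebesgue_on {0..1}) = (if i = j then 1 else 0)"
proof -
  \<comment> \<open>Indices starting at 1 make the frequency \<open>i + j - 1\<close>
    nonzero.\<close>
  have 0: "((\<lambda>x. cos (real_of_int (int i + int j - 1) * pi * x)) has_integral 0) {0..1}"
    using assms by (intro has_integral_cos_int) linarith
  have "((\<lambda>x. cos (real_of_int (int i - int j) * pi * x)) has_integral (if i = j then 1 else 0)) {0..1}"
    using has_integral_cos_int[of "int i - int j"] has_integral_const_real[of "1::real" 0 1] by auto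
  from has_integral_diff[OF this 0]
  have "((\<lambda>x. sine_basis i x * sine_basis j x) has_integral (if i = j then 1 else 0)) {0..1}"
    unfolding sine_basis_mult by simp
  then show ?thesis
    using lebesgue_integral_eq_integral[OF integrable_sine_basis_mult[of i j]] by (simp add: integral_unique)
qed

lemma nn_integral_sine_sum_square:
  assumes "finite A" "A \<subseteq> {1..}"
  shows "(\<integral>\<^sup>+x. ennreal ((\<Sum>j\<in>A. c j * sine_basis j x)\<^sup>2) \<partial>lebesgue_on {0..1}) = ennreal (\<Sum>j\<in>A. (c j)\<^sup>2)"
proof -
  have eq: "(\<Sum>j\<in>A. c j * sine_basis j x)\<^sup>2 = (\<Sum>i\<in>A. \<Sum>j\<in>A. c i * c j * (sine_basis i x * sine_basis j x))" for x
    by (simp add: power2_eq_square sum_product mult_ac)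
  have int: "integrable (lebesgue_on {0..1}) (\<lambda>x. \<Sum>i\<in>A. \<Sum>j\<in>A. c i * c j * (sine_basis i x * sine_basis j x))"
    by (intro Bochner_Integration.integrable_sum integrable_mult_right integrable_sine_basis_mult)
  have "(\<integral>x. (\<Sum>i\<in>A. \<Sum>j\<in>A. c i * c j * (sine_basis i x * sine_basis j x)) \<partial>lebesgue_on {0..1})
      = (\<Sum>i\<in>A. \<Sum>j\<in>A. c i * c j * (\<integral>x. sine_basis i x * sine_basis j x \<partial>lebesgue_on {0..1}))"
    by (simp add: integrable_sine_basis_mult)
  also have "\<dots> = (\<Sum>i\<in>A. \<Sum>j\<in>A. c i * c j * (if i = j then 1 else 0))"
    using assms(2) by (intro sum.cong refl arg_cong2[where f = "(*)"] integral_sine_basis_mult) auto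
  also have "\<dots> = (\<Sum>j\<in>A. (c j)\<^sup>2)"
    using assms(1) by (simp add: power2_eq_square if_distrib[of "(*) _"] cong: if_cong)
  finally show ?thesis
    using nn_integral_eq_integral[OF int] unfolding eq[symmetric] by simp
qed

text \<open>Fatou's lemma bounds the squared distance from the pointwise limit to \<open>S N\<close>
  by the lower limit of the distances between partial sums, and orthonormality turns those into sums
  of squared coefficients.\<close>

lemma has_sine_expansion_suminf:
  assumes c: "summable (\<lambda>j. (c j)\<^sup>2)"
    and ae: "AE t in lebesgue_on {0..1}. summable (\<lambda>j. c (Suc j) * sine_basis (Suc j) t)"
  shows "has_sine_expansion (\<lambda>t. \<Sum>j. c (Suc j) * sine_basis (Suc j) t) c"
proof -
  let ?\<mu> = "lebesgue_on {0..1::real}"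
  define f where "f t = (\<Sum>j. c (Suc j) * sine_basis (Suc j) t)" for t
  define S where "S N t = (\<Sum>j = 1..N. c j * sine_basis j t)" for N t
  have [measurable]: "sine_basis j \<in> borel_measurable ?\<mu>" for j
    by (intro measurable_restrict_space1 measurable_completion) simp
  have [measurable]: "S N \<in> borel_measurable ?\<mu>" for N unfolding S_def[abs_def] by measurable
  have f_meas: "f \<in> borel_measurable ?\<mu>" unfolding f_def[abs_def] by measurable
  have S_Suc: "S N t = (\<Sum>j<N. c (Suc j) * sine_basis (Suc j) t)" for N t
    unfolding S_def by (simp add: sum.atLeast1_atMost_eq)
  \<comment> \<open>\<open>S N\<close> ends at index \<open>N\<close>, so the error is governed by
    \<open>tail (Suc N)\<close>.\<close>
  define tail where "tail N = (\<Sum>j. (c (j + N))\<^sup>2)" for N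
  have le: "(\<integral>\<^sup>+t. ennreal ((f t - S N t)\<^sup>2) \<partial>?\<mu>) \<le> ennreal (tail (Suc N))" for N
  proof -
    have "(\<integral>\<^sup>+t. ennreal ((f t - S N t)\<^sup>2) \<partial>?\<mu>) = (\<integral>\<^sup>+t. liminf (\<lambda>m. ennreal ((S m t - S N t)\<^sup>2)) \<partial>?\<mu>)"
    proof (rule nn_integral_cong_AE, rule AE_mp[OF ae], rule AE_I2, rule impI)
      fix t assume "summable (\<lambda>j. c (Suc j) * sine_basis (Suc j) t)"
      then have "(\<lambda>m. S m t) \<longlonglongrightarrow> f t"
        unfolding S_Suc f_def by (rule summable_LIMSEQ)
      then have "(\<lambda>m. ennreal ((S m t - S N t)\<^sup>2)) \<longlonglongrightarrow> ennreal ((f t - S N t)\<^sup>2)"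
        by (intro tendsto_intros)
      then show "ennreal ((f t - S N t)\<^sup>2) = liminf (\<lambda>m. ennreal ((S m t - S N t)\<^sup>2))"
        by (rule lim_imp_Liminf[OF trivial_limit_sequentially, symmetric])
    qed
    also have "\<dots> \<le> liminf (\<lambda>m. \<integral>\<^sup>+t. ennreal ((S m t - S N t)\<^sup>2) \<partial>?\<mu>)"
      by (rule nn_integral_liminf) measurable
    also have "\<dots> \<le> ennreal (tail (Suc N))"
    proof (rule Liminf_le)
      have "(\<integral>\<^sup>+t. ennreal ((S m t - S N t)\<^sup>2) \<partial>?\<mu>) \<le> ennreal (tail (Suc N))" if "N \<le> m" for m
      proof -
        have "S m t - S N t = (\<Sum>j = Suc N..<Suc m. c j * sine_basis j t)" for t
          using sum.atLeastLessThan_concat[of 1 "Suc N" "Suc m" "\<lambda>j. c j * sine_basis j t"] that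
          by (simp add: S_def atLeastLessThanSuc_atLeastAtMost[symmetric])
        then have "(\<integral>\<^sup>+t. ennreal ((S m t - S N t)\<^sup>2) \<partial>?\<mu>) = ennreal (\<Sum>j = Suc N..<Suc m. (c j)\<^sup>2)"
          by (simp only:) (rule nn_integral_sine_sum_square, auto)
        also have "(\<Sum>j = Suc N..<Suc m. (c j)\<^sup>2) = (\<Sum>j<m - N. (c (j + Suc N))\<^sup>2)"
          using that sum.shift_bounds_nat_ivl[of "\<lambda>i. (c i)\<^sup>2" 0 "Suc N" "m - N"]
          by (simp add: atLeast0LessThan)
        also have "\<dots> \<le> tail (Suc N)"
          unfolding tail_def by (rule sum_le_suminf[OF summable_ignore_initial_segment[OF c]]) auto
        finally show ?thesis using ennreal_leI by metis
      qed
      then show "\<forall>\<^sub>F m in sequentially. (\<integral>\<^sup>+t. ennreal ((S m t - S N t)\<^sup>2) \<partial>?\<mu>) \<le> ennreal (tail (Suc N))"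
        unfolding eventually_sequentially by blast
    qed simp
    finally show ?thesis .
  qed
  have "tail \<longlonglongrightarrow> 0" unfolding tail_def by (rule suminf_exist_split2[OF c])
  then have lim: "(\<lambda>N. ennreal (tail (Suc N))) \<longlonglongrightarrow> 0"
    using tendsto_ennrealI[OF LIMSEQ_Suc] by fastforce
  have "(\<lambda>N. \<integral>\<^sup>+t. ennreal ((f t - S N t)\<^sup>2) \<partial>?\<mu>) \<longlonglongrightarrow> 0"
    by (rule tendsto_sandwich[OF _ _ tendsto_const lim]) (auto simp: le)
  then show ?thesis
    using f_meas unfolding has_sine_expansion_def f_def[abs_def] S_def by simp
qed

subsection \<open>Normal sequences with polynomially decaying weights\<close>

text \<open>By completeness, convergence is the Cauchy property, a countable combination of
  measurable conditions. The exchange of almost-everywhere quantifiers relies on this.\<close>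

lemma pred_summable [measurable]:
  fixes f :: "nat \<Rightarrow> 'a \<Rightarrow> real"
  assumes [measurable]: "\<And>i. f i \<in> borel_measurable M"
  shows "Measurable.pred M (\<lambda>x. summable (\<lambda>i. f i x))"
  unfolding summable_iff_convergent Cauchy_convergent_iff[symmetric] by measurable

lemma sqrt_2_less_exp_1: "sqrt 2 < exp (1::real)"
proof -
  have "sqrt 2 < 1 + (1::real)" by (rule real_less_lsqrt) auto
  also have "\<dots> \<le> exp 1" by (rule exp_ge_add_one_self)
  finally show ?thesis .
qed

lemma inj_affine_nat: "0 < m \<Longrightarrow> inj (\<lambda>l::nat. m * l + s)"
  by (auto simp: inj_def)

locale std_normal_sequence = prob_space M for M :: "'a measure" +
  fixes Z :: "nat \<Rightarrow> 'a \<Rightarrow> real"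
  assumes indep: "indep_vars (\<lambda>_. borel) Z {1..}"
    and std_normal: "\<And>j. 1 \<le> j \<Longrightarrow> distributed M lborel (Z j) (\<lambda>x. ennreal (std_normal_density x))"
begin

lemma measurable_Z: "1 \<le> j \<Longrightarrow> random_variable borel (Z j)"
  using indep by (simp add: indep_vars_def)

lemma Z_square:
  assumes "1 \<le> j"
  shows "integrable M (\<lambda>\<omega>. (Z j \<omega>)\<^sup>2)" "expectation (\<lambda>\<omega>. (Z j \<omega>)\<^sup>2) = 1"
proof -
  show "integrable M (\<lambda>\<omega>. (Z j \<omega>)\<^sup>2)"
    using distributed_integrable[OF std_normal[OF assms], of "\<lambda>x. x\<^sup>2"]
      integrable_std_normal_moment[of 2] by simp
  have "expectation (Z j) = 0"
    by (rule standard_normal_distributed_expectation[OF std_normal[OF assms]])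
  then show "expectation (\<lambda>\<omega>. (Z j \<omega>)\<^sup>2) = 1"
    using standard_normal_distributed_variance[OF std_normal[OF assms]] by simp
qed

lemma AE_summable_subsequence:
  assumes p: "inj p" "\<And>l. 1 \<le> p l" and w: "summable (\<lambda>l. (w l)\<^sup>2)"
  shows "AE \<omega> in M. summable (\<lambda>l. w l * Z (p l) \<omega>)"
proof (rule AE_summable_indep_vars)
  have "indep_vars (\<lambda>_. borel) (\<lambda>l. Z (p l)) UNIV"
    using p by (intro indep_vars_reindex[OF indep]) auto
  then show "indep_vars (\<lambda>_. borel) (\<lambda>l \<omega>. w l * Z (p l) \<omega>) UNIV"
    by (rule indep_vars_compose2) measurable
  have sq: "(w l * Z (p l) \<omega>)\<^sup>2 = (w l)\<^sup>2 * (Z (p l) \<omega>)\<^sup>2" for l \<omega>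
    by (rule power_mult_distrib)
  show "integrable M (\<lambda>\<omega>. (w l * Z (p l) \<omega>)\<^sup>2)" for l
    unfolding sq using Z_square(1)[OF p(2)[of l]] by simp
  show "expectation (\<lambda>\<omega>. w l * Z (p l) \<omega>) = 0" for l
    using standard_normal_distributed_expectation[OF std_normal[OF p(2)[of l]]] by simp
  show "summable (\<lambda>l. expectation (\<lambda>\<omega>. (w l * Z (p l) \<omega>)\<^sup>2))"
    unfolding sq using w Z_square(2)[OF p(2)] by simp
qed

lemma AE_block_sum_squares_less:
  "AE \<omega> in M. \<forall>\<^sub>F k in sequentially. (\<Sum>j = k..<2 * k. (Z j \<omega>)\<^sup>2) < 4 * real k"
proof -
  \<comment> \<open>Singleton blocks of unit weight give \<open>v = 1\<close>, hence the divisor 4;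
    slope 1 for \<open>Q\<close> is slope 4 for the sum.\<close>
  define Q where "Q k \<omega> = (\<Sum>j = k..<2 * k. (Z j \<omega>)\<^sup>2) / 4" for k \<omega>
  have "AE \<omega> in M. \<forall>\<^sub>F k in sequentially. Q k \<omega> < 1 * real k"
  proof (rule AE_eventually_less_exp_moment)
    show "random_variable borel (Q k)" for k
      unfolding Q_def
    proof (intro borel_measurable_divide borel_measurable_sum borel_measurable_power measurable_Z)
      \<comment> \<open>For \<open>k = 0\<close> the block is empty, so the unconstrained index 0
        never occurs.\<close>
      fix j assume "j \<in> {k..<2 * k}" then show "1 \<le> j" by (cases k) auto
    qed simp
    fix k :: nat assume k: "1 \<le> k"
    have "(\<integral>\<^sup>+\<omega>. ennreal (exp ((\<Sum>i = k..<2 * k. (\<Sum>j\<in>{i}. 1 * Z j \<omega>)\<^sup>2) / (4 * 1))) \<partial>M)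
        \<le> ennreal (sqrt 2 ^ card {k..<2 * k})"
      using k by (intro nn_integral_exp_sum_squares_blocks_le[OF indep std_normal])
        (auto simp: disjoint_family_on_def)
    then show "(\<integral>\<^sup>+\<omega>. ennreal (exp (Q k \<omega>)) \<partial>M) \<le> ennreal (sqrt 2 ^ k)"
      by (simp add: Q_def)
  next
    show "sqrt 2 < exp (1::real)" by (rule sqrt_2_less_exp_1)
  qed simp
  then show ?thesis by (simp add: Q_def mult.commute)
qed

text \<open>The negative exponent -1 gives the factor \<open>1 / sqrt 3\<close> per variable, which
  lies below \<open>exp (- 1/4)\<close> since \<open>exp (1/2) < 3\<close>.\<close>

lemma AE_block_sum_squares_greater:
  "AE \<omega> in M. \<forall>\<^sub>F k in sequentially. real k / 4 < (\<Sum>j = k..<2 * k. (Z j \<omega>)\<^sup>2)"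
proof -
  define Q where "Q k \<omega> = - 1 * (\<Sum>j = k..<2 * k. (Z j \<omega>)\<^sup>2)" for k \<omega>
  have "AE \<omega> in M. \<forall>\<^sub>F k in sequentially. Q k \<omega> < - (1 / 4) * real k"
  proof (rule AE_eventually_less_exp_moment)
    show "random_variable borel (Q k)" for k
      unfolding Q_def
    proof (intro borel_measurable_times borel_measurable_sum borel_measurable_power measurable_Z)
      fix j assume "j \<in> {k..<2 * k}" then show "1 \<le> j" by (cases k) auto
    qed simp
    fix k :: nat assume k: "1 \<le> k"
    have "(\<integral>\<^sup>+\<omega>. ennreal (exp (Q k \<omega>)) \<partial>M)
        = (\<Prod>j = k..<2 * k. \<integral>\<^sup>+\<omega>. ennreal (exp (- 1 * (Z j \<omega>)\<^sup>2)) \<partial>M)"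
      unfolding Q_def using k by (intro nn_integral_exp_sum_squares indep_vars_subset[OF indep]) auto
    also have "\<dots> = (\<Prod>j = k..<2 * k. ennreal (1 / sqrt 3))"
    proof (intro prod.cong refl)
      fix j assume "j \<in> {k..<2 * k}"
      with k have "1 \<le> j" by simp
      then show "(\<integral>\<^sup>+\<omega>. ennreal (exp (- 1 * (Z j \<omega>)\<^sup>2)) \<partial>M) = ennreal (1 / sqrt 3)"
        using nn_integral_exp_square_normal[OF std_normal, of j "- 1"] by simp
    qed
    also have "\<dots> = ennreal ((1 / sqrt 3) ^ k)" by (simp add: ennreal_power)
    finally show "(\<integral>\<^sup>+\<omega>. ennreal (exp (Q k \<omega>)) \<partial>M) \<le> ennreal ((1 / sqrt 3) ^ k)" by simp
  next
    have "exp (1 / 4) ^ 2 = exp (1 / 2 :: real)" by (simp add: exp_of_nat_mult[symmetric])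
    also have "\<dots> < exp 1" by simp
    also have "\<dots> \<le> 3" by (rule exp_le)
    finally have "exp (1 / 4) < sqrt (3 :: real)" by (rule real_less_rsqrt)
    then show "1 / sqrt 3 < exp (- (1 / 4) :: real)"
      by (simp add: exp_minus field_simps)
  qed simp
  then show ?thesis by (simp add: Q_def)
qed

end

text \<open>The bounds are imposed only from \<open>j0\<close> on, because finitely many weights of
  the actual series may be irregular or zero.\<close>

locale weighted_std_normal_sequence = std_normal_sequence +
  fixes a :: "nat \<Rightarrow> real" and \<beta> lo hi :: real and j0 :: nat
  assumes \<beta>: "0 < \<beta>" and lo: "0 < lo" and j0: "1 \<le> j0"
    and a_lower: "\<And>j. j0 \<le> j \<Longrightarrow> lo * real j powr - (1 + \<beta>) \<le> (a j)\<^sup>2"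
    and a_upper: "\<And>j. j0 \<le> j \<Longrightarrow> (a j)\<^sup>2 \<le> hi * real j powr - (1 + \<beta>)"
begin

lemma hi: "0 < hi"
proof -
  have "0 < lo * real j0 powr - (1 + \<beta>)" using lo j0 by simp
  also have "\<dots> \<le> hi * real j0 powr - (1 + \<beta>)"
    using a_lower[of j0] a_upper[of j0] by linarith
  finally show ?thesis using j0 by (simp add: zero_less_mult_iff)
qed

lemma a_nonzero: "j0 \<le> j \<Longrightarrow> a j \<noteq> 0"
  using a_lower[of j] lo j0 by (auto simp: mult_le_0_iff)

lemma summable_a_square: "summable (\<lambda>j. (a j)\<^sup>2)"
proof (rule summable_comparison_test')
  show "summable (\<lambda>j. hi * real j powr - (1 + \<beta>))"
    using \<beta> by (intro summable_mult) (simp add: summable_real_powr_iff)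
  show "norm ((a j)\<^sup>2) \<le> hi * real j powr - (1 + \<beta>)" if "j0 \<le> j" for j
    using a_upper[OF that] by simp
qed

section \<open>Dyadic blocks of the weighted sequence\<close>

lemma AE_weighted_block_upper:
  "AE \<omega> in M. \<forall>\<^sub>F k in sequentially. (\<Sum>j = k..<2 * k. (a j * Z j \<omega>)\<^sup>2) \<le> 4 * hi * real k powr - \<beta>"
  using AE_block_sum_squares_less
proof eventually_elim
  case (elim \<omega>)
  then show ?case using eventually_ge_at_top[of j0]
  proof eventually_elim
    case (elim k)
    have k: "1 \<le> k" using elim j0 by simp
    have "(\<Sum>j = k..<2 * k. (a j * Z j \<omega>)\<^sup>2) \<le> (\<Sum>j = k..<2 * k. hi * real k powr - (1 + \<beta>) * (Z j \<omega>)\<^sup>2)"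
    proof (rule sum_mono)
      fix j assume j: "j \<in> {k..<2 * k}"
      then have "(a j)\<^sup>2 \<le> hi * real j powr - (1 + \<beta>)" using elim by (intro a_upper) simp
      also have "\<dots> \<le> hi * real k powr - (1 + \<beta>)"
        using hi j k \<beta> by (intro mult_left_mono powr_mono2') auto
      finally show "(a j * Z j \<omega>)\<^sup>2 \<le> hi * real k powr - (1 + \<beta>) * (Z j \<omega>)\<^sup>2"
        unfolding power_mult_distrib by (intro mult_right_mono) auto
    qed
    also have "\<dots> = hi * real k powr - (1 + \<beta>) * (\<Sum>j = k..<2 * k. (Z j \<omega>)\<^sup>2)"
      by (simp add: sum_distrib_left)
    also have "\<dots> \<le> hi * real k powr - (1 + \<beta>) * (4 * real k)"
      using elim hi by (intro mult_left_mono) auto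
    also have "\<dots> = 4 * hi * (real k powr - (1 + \<beta>) * real k powr 1)" by simp
    also have "\<dots> = 4 * hi * real k powr - \<beta>" by (subst powr_add[symmetric]) simp
    finally show ?case .
  qed
qed

text \<open>Here the weights are compared with their bound at the right end \<open>2 * k\<close> of
  the block, which produces the factor \<open>2 powr - (1 + \<beta>)\<close>; the upper bound uses
  the left end.\<close>

lemma AE_weighted_block_lower:
  "AE \<omega> in M. \<forall>\<^sub>F k in sequentially.
     lo * 2 powr - (1 + \<beta>) / 4 * real k powr - \<beta> \<le> (\<Sum>j = k..<2 * k. (a j * Z j \<omega>)\<^sup>2)"
  using AE_block_sum_squares_greater
proof eventually_elim
  case (elim \<omega>)
  then show ?case using eventually_ge_at_top[of j0]
  proof eventually_elim
    case (elim k)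
    have k: "1 \<le> k" using elim j0 by simp
    have "lo * 2 powr - (1 + \<beta>) / 4 * real k powr - \<beta>
        = lo * 2 powr - (1 + \<beta>) / 4 * (real k powr - (1 + \<beta>) * real k powr 1)"
      by (subst powr_add[symmetric]) simp
    also have "\<dots> = lo * (2 * real k) powr - (1 + \<beta>) * (real k / 4)"
      by (simp add: powr_mult)
    also have "\<dots> \<le> lo * (2 * real k) powr - (1 + \<beta>) * (\<Sum>j = k..<2 * k. (Z j \<omega>)\<^sup>2)"
      using elim lo by (intro mult_left_mono) auto
    also have "\<dots> = (\<Sum>j = k..<2 * k. lo * (2 * real k) powr - (1 + \<beta>) * (Z j \<omega>)\<^sup>2)"
      by (simp add: sum_distrib_left)
    also have "\<dots> \<le> (\<Sum>j = k..<2 * k. (a j * Z j \<omega>)\<^sup>2)"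
    proof (rule sum_mono)
      fix j assume j: "j \<in> {k..<2 * k}"
      then have "lo * (2 * real k) powr - (1 + \<beta>) \<le> lo * real j powr - (1 + \<beta>)"
        using lo k \<beta> by (intro mult_left_mono powr_mono2') auto
      also have "\<dots> \<le> (a j)\<^sup>2" using elim j by (intro a_lower) simp
      finally show "lo * (2 * real k) powr - (1 + \<beta>) * (Z j \<omega>)\<^sup>2 \<le> (a j * Z j \<omega>)\<^sup>2"
        unfolding power_mult_distrib by (intro mult_right_mono) auto
    qed
    finally show ?case .
  qed
qed

section \<open>Almost sure convergence of the aliasing and sine series\<close>

lemma AE_summable_weighted_subsequence:
  assumes p: "inj p" "\<And>l. 1 \<le> p l"
  shows "AE \<omega> in M. summable (\<lambda>l. a (p l) * Z (p l) \<omega>)"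
  using summable_reindex[OF summable_a_square p(1)]
  by (intro AE_summable_subsequence p) (simp add: comp_def)

text \<open>The two halves of the aliasing term run along arithmetic progressions of positive
  indices, and each converges separately by independence.\<close>

lemma AE_summable_aliasing_term:
  "AE \<omega> in M. \<forall>n i. i \<in> {1..n} \<longrightarrow> summable (aliasing_term (\<lambda>j. a j * Z j \<omega>) n i)"
proof (subst AE_all_countable, intro allI, subst AE_all_countable, intro allI)
  fix n i :: nat
  show "AE \<omega> in M. i \<in> {1..n} \<longrightarrow> summable (aliasing_term (\<lambda>j. a j * Z j \<omega>) n i)"
  proof (cases "i \<in> {1..n}")
    case True
    have "AE \<omega> in M. summable (\<lambda>l. a ((2*n+1) * l + i) * Z ((2*n+1) * l + i) \<omega>)"
      using True by (intro AE_summable_weighted_subsequence inj_affine_nat) auto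
    moreover have "AE \<omega> in M. summable (\<lambda>l. a ((2*n+1) * l + (2*n+2-i)) * Z ((2*n+1) * l + (2*n+2-i)) \<omega>)"
      using True by (intro AE_summable_weighted_subsequence inj_affine_nat) auto
    ultimately show ?thesis
      by eventually_elim (auto simp: aliasing_term_def[abs_def] intro: summable_diff)
  qed auto
qed

text \<open>For fixed \<open>t\<close> the exceptional null set depends on \<open>t\<close>; Fubini,
  in the form \<open>AE_commute\<close>, exchanges the two quantifiers.\<close>

lemma AE_AE_summable_sine:
  "AE \<omega> in M. AE t in lebesgue_on {0..1}. summable (\<lambda>j. a (Suc j) * Z (Suc j) \<omega> * sine_basis (Suc j) t)"
proof -
  interpret L: finite_measure "lebesgue_on {0..1::real}"
    by (rule finite_measure_lebesgue_on) simp
  interpret pair_sigma_finite M "lebesgue_on {0..1::real}" ..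
  have [measurable]: "sine_basis j \<in> borel_measurable (lebesgue_on {0..1})" for j
    by (intro measurable_restrict_space1 measurable_completion) simp
  have [measurable]: "random_variable borel (Z (Suc j))" for j
    by (rule measurable_Z) simp
  have "AE \<omega> in M. summable (\<lambda>j. a (Suc j) * Z (Suc j) \<omega> * sine_basis (Suc j) t)" for t
  proof -
    have "\<bar>sin x\<bar> \<le> 1 \<Longrightarrow> (sin x)\<^sup>2 \<le> 1" for x :: real
      by (simp add: abs_square_le_1)
    then have sine: "(sine_basis j t)\<^sup>2 \<le> 2" for j
      by (simp add: sine_basis_def power_mult_distrib)
    have "summable (\<lambda>j. (a (Suc j))\<^sup>2 * 2)"
      using summable_a_square by (intro summable_mult2) (subst summable_Suc_iff)
    then have "summable (\<lambda>j. (a (Suc j) * sine_basis (Suc j) t)\<^sup>2)"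
      by (rule summable_comparison_test'[where N = 0])
        (simp add: power_mult_distrib mult_left_mono sine)
    then have "AE \<omega> in M. summable (\<lambda>j. (a (Suc j) * sine_basis (Suc j) t) * Z (Suc j) \<omega>)"
      by (intro AE_summable_subsequence) auto
    then show ?thesis by (simp add: mult_ac)
  qed
  then have "AE t in lebesgue_on {0..1}. AE \<omega> in M. summable (\<lambda>j. a (Suc j) * Z (Suc j) \<omega> * sine_basis (Suc j) t)"
    by simp
  then show ?thesis
    by (subst AE_commute) measurable
qed

section \<open>Size of the aliasing remainders\<close>

text \<open>Indices growing at least like \<open>n * Suc l\<close> let the factor
  \<open>n powr - (1 + \<beta>)\<close> be pulled out of a convergent series, so the whole sum has
  the order of a single squared weight at \<open>n\<close>.\<close>

lemma sum_a_square_le: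
  assumes n: "max 1 j0 \<le> n" and p: "\<And>l. l < N \<Longrightarrow> n * Suc l \<le> p l"
  shows "(\<Sum>l<N. (a (p l))\<^sup>2) \<le> hi * (\<Sum>l. real (Suc l) powr - (1 + \<beta>)) * real n powr - (1 + \<beta>)"
proof -
  have summ: "summable (\<lambda>l. real (Suc l) powr - (1 + \<beta>))"
    using \<beta> summable_Suc_iff[of "\<lambda>l. real l powr - (1 + \<beta>)"] by (simp add: summable_real_powr_iff del: of_nat_Suc)
  have "(\<Sum>l<N. (a (p l))\<^sup>2) \<le> (\<Sum>l<N. hi * real n powr - (1 + \<beta>) * real (Suc l) powr - (1 + \<beta>))"
  proof (rule sum_mono)
    fix l assume "l \<in> {..<N}"
    then have l: "n * Suc l \<le> p l" by (intro p) simp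
    have "n \<le> n * Suc l" by simp
    with l n have "j0 \<le> p l" by linarith
    then have "(a (p l))\<^sup>2 \<le> hi * real (p l) powr - (1 + \<beta>)" by (rule a_upper)
    also have "\<dots> \<le> hi * real (n * Suc l) powr - (1 + \<beta>)"
    proof (intro mult_left_mono powr_mono2')
      show "0 < real (n * Suc l)" using n by (simp only: of_nat_0_less_iff) simp
      show "real (n * Suc l) \<le> real (p l)" using l by (simp only: of_nat_le_iff)
    qed (use hi \<beta> in auto)
    also have "\<dots> = hi * real n powr - (1 + \<beta>) * real (Suc l) powr - (1 + \<beta>)"
      by (simp only: of_nat_mult) (simp add: powr_mult del: of_nat_Suc)
    finally show "(a (p l))\<^sup>2 \<le> hi * real n powr - (1 + \<beta>) * real (Suc l) powr - (1 + \<beta>)" .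
  qed
  also have "\<dots> = hi * real n powr - (1 + \<beta>) * (\<Sum>l<N. real (Suc l) powr - (1 + \<beta>))"
    by (simp add: sum_distrib_left)
  also have "\<dots> \<le> hi * real n powr - (1 + \<beta>) * (\<Sum>l. real (Suc l) powr - (1 + \<beta>))"
    using hi by (intro mult_left_mono sum_le_suminf summ) auto
  finally show ?thesis by (simp add: mult_ac)
qed

text \<open>The remainders are infinite series, so the block estimate is applied to truncations
  \<open>R N i\<close>, with a bound uniform in \<open>N\<close>, and Fatou's lemma passes to the
  limit. The factor 2 in \<open>v\<close> accounts for the two progressions.\<close>

lemma nn_integral_exp_aliasing_remainder_le:
  assumes n: "max 1 j0 \<le> n"
    and v: "v = 2 * hi * (\<Sum>l. real (Suc l) powr - (1 + \<beta>)) * real n powr - (1 + \<beta>)"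
  shows "(\<integral>\<^sup>+\<omega>. ennreal (exp ((\<Sum>i = 1..n. (aliasing_remainder (\<lambda>j. a j * Z j \<omega>) n i)\<^sup>2) / (4 * v))) \<partial>M)
    \<le> ennreal (sqrt 2 ^ n)"
proof -
  define c where "c \<omega> j = a j * Z j \<omega>" for \<omega> j
  \<comment> \<open>\<open>f\<close> lists the indices of positive sign from \<open>l = 1\<close>
    on, \<open>g\<close> those of negative sign from \<open>l = 0\<close> on. Hence \<open>N\<close>
    values of \<open>f\<close> go with \<open>Suc N\<close> values of \<open>g\<close>.\<close>
  define f where "f i l = (2 * n + 1) * Suc l + i" for i l
  define g where "g i l = (2 * n + 1) * l + (2 * n + 2 - i)" for i l
  define J where "J N i = f i ` {..<N} \<union> g i ` {..<Suc N}" for N i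
  define u where "u N i j = (if j \<in> g i ` {..<Suc N} then - a j else a j)" for N i j
  define R where "R N i \<omega> = (\<Sum>j\<in>J N i. u N i j * Z j \<omega>)" for N i \<omega>
  have inj: "inj (f i)" "inj (g i)" for i
    using inj_affine_nat[of "2 * n + 1" "2 * n + 1 + i"] inj_affine_nat[of "2 * n + 1" "2 * n + 2 - i"]
    by (simp_all add: f_def[abs_def] g_def[abs_def] algebra_simps)
  \<comment> \<open>The residue of \<open>j - 1\<close> modulo \<open>2n + 1\<close> recovers \<open>i\<close>, so the index sets \<open>J N i\<close> are disjoint.\<close>
  have f_mod: "(f i l - 1) mod (2 * n + 1) = i - 1" if "i \<in> {1..n}" for i l
  proof -
    have "f i l - 1 = (2 * n + 1) * Suc l + (i - 1)" using that by (simp add: f_def)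
    moreover have "((2 * n + 1) * Suc l + (i - 1)) mod (2 * n + 1) = i - 1"
      using that by (simp only: mod_mult_self4) auto
    ultimately show ?thesis by simp
  qed
  \<comment> \<open>These residues are at least \<open>n + 1\<close> and those of \<open>f\<close>
    at most \<open>n - 1\<close>, so the two progressions never meet.\<close>
  have g_mod: "(g i l - 1) mod (2 * n + 1) = 2 * n + 1 - i" if "i \<in> {1..n}" for i l
  proof -
    have "g i l - 1 = (2 * n + 1) * l + (2 * n + 1 - i)" using that by (simp add: g_def)
    moreover have "((2 * n + 1) * l + (2 * n + 1 - i)) mod (2 * n + 1) = 2 * n + 1 - i"
      using that by (simp only: mod_mult_self4) auto
    ultimately show ?thesis by simp
  qed
  have fg: "f i ` A \<inter> g i ` B = {}" if i: "i \<in> {1..n}" for i A B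
  proof -
    have "f i l \<noteq> g i l'" for l l'
      using f_mod[OF i, of l] g_mod[OF i, of l'] i by auto
    then show ?thesis by auto
  qed
  have f_ge: "n * Suc l \<le> f i l" for i l by (simp add: f_def)
  have g_ge: "n * Suc l \<le> g i l" if "i \<in> {1..n}" for i l
  proof -
    have "n * Suc l = n * l + n" by simp
    also have "\<dots> \<le> (2 * n + 1) * l + (2 * n + 2 - i)"
      using that by (intro add_mono mult_le_mono1) auto
    finally show ?thesis by (simp add: g_def)
  qed
  have J_ge: "n \<le> j" if "i \<in> {1..n}" "j \<in> J N i" for i j N
  proof -
    have "n \<le> n * Suc l" for l by simp
    then show ?thesis
      using that(2) order_trans[OF _ f_ge] order_trans[OF _ g_ge[OF that(1)]] by (auto simp: J_def)
  qed
  have sum_J: "(\<Sum>j\<in>J N i. h j) = (\<Sum>l<N. h (f i l)) + (\<Sum>l<Suc N. h (g i l))"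
    if "i \<in> {1..n}" for h :: "nat \<Rightarrow> real" and N i
    unfolding J_def using fg[OF that] inj
    by (subst sum.union_disjoint) (simp_all add: sum.reindex inj_on_subset[OF _ subset_UNIV] comp_def del: sum.lessThan_Suc)
  have R_eq: "R N i \<omega> = (\<Sum>l<Suc N. aliasing_term (c \<omega>) n i l) - c \<omega> i" if i: "i \<in> {1..n}" for N i \<omega>
  proof -
    have "f i l \<notin> g i ` {..<Suc N}" for l
      using fg[OF i, of "{l}" "{..<Suc N}"] by auto
    then have "R N i \<omega> = (\<Sum>l<N. c \<omega> (f i l)) + (\<Sum>l<Suc N. - c \<omega> (g i l))"
      unfolding R_def sum_J[OF i] by (intro arg_cong2[where f = "(+)"] sum.cong) (auto simp: u_def c_def)
    also have "\<dots> = (\<Sum>l<Suc N. c \<omega> ((2 * n + 1) * l + i)) - c \<omega> i - (\<Sum>l<Suc N. c \<omega> (g i l))"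
      by (subst (2) sum.lessThan_Suc_shift) (simp add: f_def sum_negf del: sum.lessThan_Suc)
    also have "\<dots> = (\<Sum>l<Suc N. aliasing_term (c \<omega>) n i l) - c \<omega> i"
      by (simp add: aliasing_term_def g_def sum_subtractf del: sum.lessThan_Suc)
    finally show ?thesis .
  qed
  have R_meas: "random_variable borel (R N i)" if "i \<in> {1..n}" for N i
  proof -
    have "random_variable borel (Z j)" if "j \<in> J N i" for j
      using J_ge[OF \<open>i \<in> {1..n}\<close> that] n by (intro measurable_Z) simp
    then show ?thesis unfolding R_def by (intro borel_measurable_sum borel_measurable_times) auto
  qed
  define F where "F N \<omega> = ennreal (exp ((\<Sum>i = 1..n. (R N i \<omega>)\<^sup>2) / (4 * v)))" for N \<omega>
  have F_meas: "F N \<in> borel_measurable M" for N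
    unfolding F_def using R_meas by (auto intro!: borel_measurable_sum borel_measurable_power)
  have F_le: "(\<integral>\<^sup>+\<omega>. F N \<omega> \<partial>M) \<le> ennreal (sqrt 2 ^ n)" for N
  proof -
    have "(\<integral>\<^sup>+\<omega>. F N \<omega> \<partial>M) \<le> ennreal (sqrt 2 ^ card {1..n})"
      unfolding F_def R_def
    proof (rule nn_integral_exp_sum_squares_blocks_le[OF indep std_normal])
      fix i assume i: "i \<in> {1..n}"
      show "J N i \<subseteq> {1..}" using J_ge[OF i] n by force
      show "J N i \<noteq> {}" "finite (J N i)" by (auto simp: J_def)
      show "u N i j \<noteq> 0" if "j \<in> J N i" for j
        using a_nonzero[of j] J_ge[OF i that] n by (simp add: u_def)
      have "(\<Sum>j\<in>J N i. (u N i j)\<^sup>2) = (\<Sum>j\<in>J N i. (a j)\<^sup>2)"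
        by (intro sum.cong) (auto simp: u_def)
      also have "\<dots> = (\<Sum>l<N. (a (f i l))\<^sup>2) + (\<Sum>l<Suc N. (a (g i l))\<^sup>2)"
        by (rule sum_J[OF i])
      also have "\<dots> \<le> v / 2 + v / 2"
        using sum_a_square_le[OF n, of N "f i"] sum_a_square_le[OF n, of "Suc N" "g i"] f_ge g_ge[OF i]
        by (intro add_mono) (simp_all add: v del: sum.lessThan_Suc)
      finally show "(\<Sum>j\<in>J N i. (u N i j)\<^sup>2) \<le> v" by simp
    next
      show "disjoint_family_on (J N) {1..n}"
        unfolding disjoint_family_on_def
      proof (intro ballI impI)
        fix i i' assume i: "i \<in> {1..n}" "i' \<in> {1..n}" "i \<noteq> i'"
        have "f i l \<noteq> f i' l'" "f i l \<noteq> g i' l'" "g i l \<noteq> f i' l'" "g i l \<noteq> g i' l'" for l l'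
          using f_mod[OF i(1), of l] g_mod[OF i(1), of l] f_mod[OF i(2), of l'] g_mod[OF i(2), of l'] i
          by auto
        then show "J N i \<inter> J N i' = {}" by (auto simp: J_def)
      qed
    qed auto
    then show ?thesis by simp
  qed
  have "AE \<omega> in M. ennreal (exp ((\<Sum>i = 1..n. (aliasing_remainder (c \<omega>) n i)\<^sup>2) / (4 * v))) = liminf (\<lambda>N. F N \<omega>)"
    using AE_summable_aliasing_term
  proof eventually_elim
    case (elim \<omega>)
    have "(\<lambda>N. R N i \<omega>) \<longlonglongrightarrow> aliasing_remainder (c \<omega>) n i" if i: "i \<in> {1..n}" for i
    proof -
      have "summable (aliasing_term (c \<omega>) n i)" using elim i by (simp add: c_def[abs_def])
      then show ?thesis
        unfolding R_eq[OF i] aliasing_remainder_def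
        by (intro tendsto_diff tendsto_const LIMSEQ_Suc summable_LIMSEQ)
    qed
    then have "(\<lambda>N. F N \<omega>) \<longlonglongrightarrow> ennreal (exp ((\<Sum>i = 1..n. (aliasing_remainder (c \<omega>) n i)\<^sup>2) / (4 * v)))"
      unfolding F_def divide_inverse by (intro tendsto_ennrealI tendsto_intros)
    then show ?case by (rule lim_imp_Liminf[OF trivial_limit_sequentially, symmetric])
  qed
  then have "(\<integral>\<^sup>+\<omega>. ennreal (exp ((\<Sum>i = 1..n. (aliasing_remainder (c \<omega>) n i)\<^sup>2) / (4 * v))) \<partial>M)
      = (\<integral>\<^sup>+\<omega>. liminf (\<lambda>N. F N \<omega>) \<partial>M)"
    by (rule nn_integral_cong_AE)
  also have "\<dots> \<le> liminf (\<lambda>N. \<integral>\<^sup>+\<omega>. F N \<omega> \<partial>M)"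
    by (rule nn_integral_liminf[OF F_meas])
  also have "\<dots> \<le> ennreal (sqrt 2 ^ n)"
    by (rule Liminf_le) (simp_all add: F_le)
  finally show ?thesis by (simp add: c_def[abs_def])
qed

text \<open>The sum of \<open>n\<close> squares is eventually below \<open>n * 4 * v n\<close>, and
  the factor \<open>n\<close> raises the power from \<open>- (1 + \<beta>)\<close> to
  \<open>- \<beta>\<close>. The constant \<open>8 * hi * s\<close> does not depend on the
  realisation.\<close>

lemma AE_aliasing_remainder_le:
  obtains D where "0 \<le> D" "AE \<omega> in M. \<forall>\<^sub>F n in sequentially.
     (\<Sum>i = 1..n. (aliasing_remainder (\<lambda>j. a j * Z j \<omega>) n i)\<^sup>2) \<le> D * real n powr - \<beta>"
proof
  define s where "s = (\<Sum>l. real (Suc l) powr - (1 + \<beta>))"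
  define v where "v n = 2 * hi * s * real n powr - (1 + \<beta>)" for n
  define Q where "Q n \<omega> = (\<Sum>i = 1..n. (aliasing_remainder (\<lambda>j. a j * Z j \<omega>) n i)\<^sup>2) / (4 * v n)" for n \<omega>
  have "summable (\<lambda>l. real (Suc l) powr - (1 + \<beta>))"
    using \<beta> summable_Suc_iff[of "\<lambda>l. real l powr - (1 + \<beta>)"] by (simp add: summable_real_powr_iff del: of_nat_Suc)
  then have s: "0 < s" unfolding s_def by (intro suminf_pos) auto
  then show "0 \<le> 8 * hi * s" using hi by simp
  have Q_meas: "random_variable borel (Q n)" for n
  proof -
    have "random_variable borel (\<lambda>\<omega>. aliasing_remainder (\<lambda>j. a j * Z j \<omega>) n i)" if i: "i \<in> {1..n}" for i
    proof -
      have [measurable]: "random_variable borel (Z i)"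
        "random_variable borel (Z ((2*n+1) * l + i))" "random_variable borel (Z ((2*n+1) * l + (2*n+2-i)))" for l
        using i by (auto intro!: measurable_Z)
      show ?thesis unfolding aliasing_remainder_def aliasing_term_def by measurable
    qed
    then show ?thesis unfolding Q_def
      by (intro borel_measurable_divide borel_measurable_sum borel_measurable_power) auto
  qed
  have "AE \<omega> in M. \<forall>\<^sub>F n in sequentially. Q n \<omega> < 1 * real n"
  proof (rule AE_eventually_less_exp_moment[OF Q_meas])
    show "(\<integral>\<^sup>+\<omega>. ennreal (exp (Q n \<omega>)) \<partial>M) \<le> ennreal (sqrt 2 ^ n)" if "max 1 j0 \<le> n" for n
      unfolding Q_def by (rule nn_integral_exp_aliasing_remainder_le[OF that]) (simp add: v_def s_def)
    show "sqrt 2 < exp (1 :: real)" by (rule sqrt_2_less_exp_1)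
  qed simp
  then show "AE \<omega> in M. \<forall>\<^sub>F n in sequentially.
     (\<Sum>i = 1..n. (aliasing_remainder (\<lambda>j. a j * Z j \<omega>) n i)\<^sup>2) \<le> 8 * hi * s * real n powr - \<beta>"
  proof eventually_elim
    case (elim \<omega>)
    then show ?case using eventually_ge_at_top[of 1]
    proof eventually_elim
      case (elim n)
      have v: "0 < v n" using elim hi s by (simp add: v_def)
      then have "(\<Sum>i = 1..n. (aliasing_remainder (\<lambda>j. a j * Z j \<omega>) n i)\<^sup>2) \<le> real n * (4 * v n)"
        using elim(1) by (simp add: Q_def divide_less_eq)
      also have "\<dots> = 8 * hi * s * (real n powr - (1 + \<beta>) * real n powr 1)"
        by (simp add: v_def)
      also have "\<dots> = 8 * hi * s * real n powr - \<beta>"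
        by (subst powr_add[symmetric]) simp
      finally show ?case .
    qed
  qed
qed

section \<open>Polished tails of weighted normal series and of W\<close>

theorem AE_polished_tail_weighted:
  "AE \<omega> in M. polished_tail (\<lambda>t. \<Sum>j. a (Suc j) * Z (Suc j) \<omega> * sine_basis (Suc j) t) \<and>
     discrete_polished_tail (\<lambda>t. \<Sum>j. a (Suc j) * Z (Suc j) \<omega> * sine_basis (Suc j) t)"
proof -
  obtain D where D: "0 \<le> D" "AE \<omega> in M. \<forall>\<^sub>F n in sequentially.
     (\<Sum>i = 1..n. (aliasing_remainder (\<lambda>j. a j * Z j \<omega>) n i)\<^sup>2) \<le> D * real n powr - \<beta>"
    by (rule AE_aliasing_remainder_le)
  show ?thesis
    using AE_weighted_block_upper AE_weighted_block_lower AE_summable_aliasing_term D(2) AE_AE_summable_sine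
  proof eventually_elim
    case (elim \<omega>)
    have b: "0 < lo * 2 powr - (1 + \<beta>) / 4" using lo by simp
    have pt: "polished_tail_coeffs (\<lambda>j. a j * Z j \<omega>)"
      by (rule polished_tail_coeffs_of_dyadic_blocks[OF \<beta> b elim(1,2)])
    moreover have "discrete_polished_tail_coeffs (\<lambda>j. a j * Z j \<omega>)"
      using elim(3) by (intro discrete_polished_tail_coeffs_of_dyadic_blocks[OF \<beta> b D(1) elim(1,2) _ elim(4)]) blast
    moreover have "has_sine_expansion (\<lambda>t. \<Sum>j. a (Suc j) * Z (Suc j) \<omega> * sine_basis (Suc j) t) (\<lambda>j. a j * Z j \<omega>)"
      using pt elim(5) unfolding polished_tail_coeffs_def by (intro has_sine_expansion_suminf) auto
    ultimately show ?case unfolding polished_tail_def discrete_polished_tail_def by blast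
  qed
qed

end

theorem proposition36:
  fixes M :: "'a measure" and Z :: "nat \<Rightarrow> 'a \<Rightarrow> real" and \<alpha> \<delta> :: real
  assumes "prob_space M"
    and "prob_space.indep_vars M (\<lambda>_. borel) Z {1..}"
    and "\<And>j. j \<ge> 1 \<Longrightarrow> distributed M lborel (Z j) (\<lambda>x. ennreal (std_normal_density x))"
    and "\<alpha> > 0"
  shows "AE \<omega> in M. polished_tail (W \<alpha> \<delta> Z \<omega>) \<and> discrete_polished_tail (W \<alpha> \<delta> Z \<omega>)"
proof -
  define a where "a j = 1 / (real j + \<delta>) powr (1/2 + \<alpha>)" for j
  \<comment> \<open>From \<open>j0\<close> on, \<open>j\<close> exceeds twice the modulus of
    \<delta>, so \<open>j + \<delta>\<close> lies between \<open>j / 2\<close> and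
    \<open>2 * j\<close>.\<close>
  define j0 where "j0 = nat \<lceil>2 * \<bar>\<delta>\<bar>\<rceil> + 1"
  have shift: "1 / 2 * real j \<le> real j + \<delta>" "real j + \<delta> \<le> 2 * real j" "0 < real j" if "j0 \<le> j" for j
  proof -
    have "2 * \<bar>\<delta>\<bar> + 1 \<le> real j0" unfolding j0_def by linarith
    with that have "2 * \<bar>\<delta>\<bar> + 1 \<le> real j" by linarith
    then show "1 / 2 * real j \<le> real j + \<delta>" "real j + \<delta> \<le> 2 * real j" "0 < real j" by linarith+
  qed
  have sq: "(a j)\<^sup>2 = (real j + \<delta>) powr - (1 + 2 * \<alpha>)" for j
  proof -
    have "(a j)\<^sup>2 = 1 / ((real j + \<delta>) powr (1/2 + \<alpha>) * (real j + \<delta>) powr (1/2 + \<alpha>))"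
      by (simp add: a_def power2_eq_square)
    also have "\<dots> = (real j + \<delta>) powr - (1 + 2 * \<alpha>)"
      by (subst powr_add[symmetric]) (simp add: powr_minus_divide[symmetric])
    finally show ?thesis .
  qed
  \<comment> \<open>Here \<beta> = 2\<alpha>; the negative power turns the upper factor 2 of the
    shift into the lower weight constant, and the lower factor 1/2 into the upper one.\<close>
  interpret weighted_std_normal_sequence M Z a "2 * \<alpha>" "2 powr - (1 + 2 * \<alpha>)" "(1 / 2) powr - (1 + 2 * \<alpha>)" j0
  proof (intro weighted_std_normal_sequence.intro std_normal_sequence.intro assms(1)
      std_normal_sequence_axioms.intro weighted_std_normal_sequence_axioms.intro)
    fix j assume j: "j0 \<le> j"
    have "2 powr - (1 + 2 * \<alpha>) * real j powr - (1 + 2 * \<alpha>) = (2 * real j) powr - (1 + 2 * \<alpha>)"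
      by (simp add: powr_mult)
    also have "\<dots> \<le> (a j)\<^sup>2"
      unfolding sq using shift[OF j] \<open>0 < \<alpha>\<close> by (intro powr_mono2') auto
    finally show "2 powr - (1 + 2 * \<alpha>) * real j powr - (1 + 2 * \<alpha>) \<le> (a j)\<^sup>2" .
    have "(a j)\<^sup>2 \<le> (1 / 2 * real j) powr - (1 + 2 * \<alpha>)"
      unfolding sq using shift[OF j] \<open>0 < \<alpha>\<close> by (intro powr_mono2') auto
    also have "\<dots> = (1 / 2) powr - (1 + 2 * \<alpha>) * real j powr - (1 + 2 * \<alpha>)"
      by (rule powr_mult)
    finally show "(a j)\<^sup>2 \<le> (1 / 2) powr - (1 + 2 * \<alpha>) * real j powr - (1 + 2 * \<alpha>)" .
  qed (use assms in \<open>auto simp: j0_def\<close>)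
  have "W \<alpha> \<delta> Z \<omega> = (\<lambda>t. \<Sum>j. a (Suc j) * Z (Suc j) \<omega> * sine_basis (Suc j) t)" for \<omega>
    by (simp add: W_def[abs_def] W_coeff_def a_def)
  then show ?thesis using AE_polished_tail_weighted by simp
qed

end
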